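(* Let $f:\mathbb{R}_+\to\mathbb{R}_+$ be a positive function in $L^1_{loc}(\mathbb{R}_+)$. For any absolutely continuous function $q:[0,T]\to\mathbb{R}$ with $q(0)=q(T)$ (write $q_t=q(t)$, $q_0=q(0)$, $v_t=-q'(t)$), the associated cash process $(X_t)_{t\in[0,T]}$, defined by $$dS_t=\sigma\,dW_t-f(|q_0-q_t|)\,v_t\,dt,\qquad dX_t=v_tS_t\,dt-h(t,v_t)\,v_t\,dt,$$ satisfies $\mathbb{E}[X_T]\le X_0$.
   Context: $(\Omega,\mathcal{F},(\mathcal{F}_t)_{t\ge 0},\mathbb{P})$ is a filtered probability space satisfying the usual conditions, carrying a standard one-dimensional Brownian motion $W$ with $W_0=0$; $T>0$ and $\sigma>0$ are constants; the initial price $S_0$ and initial cash $X_0$ are deterministic real numbers. A strategy is a deterministic absolutely continuous function $q:[0,T]\to\mathbb{R}$ (number of shares held). The function $h:[0,T]\times\mathbb{R}\to\mathbb{R}$ (instantaneous market impact) is measurable and $h(t,v)$ has the same sign as $v$, so that $h(t,v)v\ge 0$ for all $(t,v)$ (the case $h=0$ is allowed). The dynamics are understood in integral form, all Lebesgue integrals being assumed well defined: $t\mapsto f(|q_0-q_t|)v_t$ and $t\mapsto h(t,v_t)v_t$ are integrable on $[0,T]$, where $f(|q_0-q_t|)v_t$ is taken to be $0$ when $v_t=0$. *)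

theory Defs
  imports "HOL-Probability.Probability"
begin

text \<open>
  Time is indexed by \<^typ>\<open>real\<close>; only the values at times \<open>t \<ge> 0\<close> are constrained or used.
\<close>

locale filtered_prob_space = prob_space M + complete_measure M for M :: "'a measure" +
  fixes F :: "real \<Rightarrow> 'a measure"
  assumes F_subalgebra: "0 \<le> t \<Longrightarrow> subalgebra M (F t)"
    and F_mono: "0 \<le> s \<Longrightarrow> s \<le> t \<Longrightarrow> sets (F s) \<subseteq> sets (F t)"
    and F_null_sets: "null_sets M \<subseteq> sets (F 0)"
    and F_right_continuous: "0 \<le> s \<Longrightarrow> sets (F s) = (\<Inter>t\<in>{s<..}. sets (F t))"

locale brownian_motion = filtered_prob_space M F for M :: "'a measure" and F +
  fixes W :: "real \<Rightarrow> 'a \<Rightarrow> real"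
  assumes W_adapted: "0 \<le> t \<Longrightarrow> W t \<in> borel_measurable (F t)"
    and W_zero: "AE \<omega> in M. W 0 \<omega> = 0"
    and W_increment_normal: "0 \<le> s \<Longrightarrow> s < t \<Longrightarrow>
      distributed M lborel (\<lambda>\<omega>. W t \<omega> - W s \<omega>) (normal_density 0 (sqrt (t - s)))"
    and W_increment_indep: "0 \<le> s \<Longrightarrow> s < t \<Longrightarrow>
      indep_set (sets (F s)) {(\<lambda>\<omega>. W t \<omega> - W s \<omega>) -` B \<inter> space M |B. B \<in> sets borel}"
    and W_continuous: "AE \<omega> in M. continuous_on {0..} (\<lambda>t. W t \<omega>)"

text \<open>
  The \<open>\<epsilon>\<close>-\<open>\<delta>\<close> notion for functions on an interval; the constant \<open>absolutely_continuous\<close> of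
  HOL-Analysis is the unrelated notion for measures.
\<close>

definition absolutely_continuous_fun_on :: "real set \<Rightarrow> (real \<Rightarrow> real) \<Rightarrow> bool" where
  "absolutely_continuous_fun_on I q \<longleftrightarrow>
    (\<forall>\<epsilon>>0. \<exists>\<delta>>0. \<forall>(n::nat) a b.
      (\<forall>i<n. a i \<le> b i \<and> {a i..b i} \<subseteq> I) \<longrightarrow>
      disjoint_family_on (\<lambda>i. {a i<..<b i}) {..<n} \<longrightarrow>
      (\<Sum>i<n. b i - a i) < \<delta> \<longrightarrow>
      (\<Sum>i<n. \<bar>q (b i) - q (a i)\<bar>) < \<epsilon>)"

text \<open>
  \<open>v = - q'\<close> at every point of \<open>[0, T]\<close> where \<open>q\<close> is differentiable; the values of \<open>v\<close> on the
  remaining points, a null set when \<open>q\<close> is absolutely continuous, are left arbitrary.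
\<close>

definition trading_rate :: "real \<Rightarrow> (real \<Rightarrow> real) \<Rightarrow> (real \<Rightarrow> real) \<Rightarrow> bool" where
  "trading_rate T q v \<longleftrightarrow>
    (\<forall>t\<in>{0..T}. \<forall>D. (q has_real_derivative D) (at t within {0..T}) \<longrightarrow> v t = - D)"

definition locally_integrable_halfline :: "(real \<Rightarrow> real) \<Rightarrow> bool" where
  "locally_integrable_halfline f \<longleftrightarrow>
    (\<forall>K. compact K \<longrightarrow> K \<subseteq> {0..} \<longrightarrow> set_integrable lebesgue K f)"

text \<open>
  The dynamics in integral form, holding almost surely for all times in \<open>[0, T]\<close>. The stochastic
  integral of the constant \<open>\<sigma>\<close> is \<open>\<sigma> (W t - W 0) = \<sigma> W t\<close>. For \<open>v s = 0\<close> the integrand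
  \<open>f \<bar>q 0 - q s\<bar> * v s\<close> vanishes whatever the value of \<open>f\<close>.
\<close>

definition price_process ::
  "'a measure \<Rightarrow> (real \<Rightarrow> 'a \<Rightarrow> real) \<Rightarrow> real \<Rightarrow> real \<Rightarrow> (real \<Rightarrow> real) \<Rightarrow>
    (real \<Rightarrow> real) \<Rightarrow> (real \<Rightarrow> real) \<Rightarrow> real \<Rightarrow> (real \<Rightarrow> 'a \<Rightarrow> real) \<Rightarrow> bool" where
  "price_process M W T \<sigma> f q v S\<^sub>0 S \<longleftrightarrow>
    (AE \<omega> in M. \<forall>t\<in>{0..T}.
      S t \<omega> = S\<^sub>0 + \<sigma> * W t \<omega> - (LINT s:{0..t}|lebesgue. f \<bar>q 0 - q s\<bar> * v s))"

definition cash_process ::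
  "'a measure \<Rightarrow> real \<Rightarrow> (real \<Rightarrow> real \<Rightarrow> real) \<Rightarrow> (real \<Rightarrow> real) \<Rightarrow>
    (real \<Rightarrow> 'a \<Rightarrow> real) \<Rightarrow> real \<Rightarrow> (real \<Rightarrow> 'a \<Rightarrow> real) \<Rightarrow> bool" where
  "cash_process M T h v S X\<^sub>0 X \<longleftrightarrow>
    (AE \<omega> in M. \<forall>t\<in>{0..T}.
      X t \<omega> = X\<^sub>0 + (LINT s:{0..t}|lebesgue. v s * S s \<omega>)
                  - (LINT s:{0..t}|lebesgue. h s (v s) * v s))"

end

theory Submission
  imports Defs
begin

text \<open>
  Write \<open>x\<^sub>t = q\<^sub>t - q\<^sub>0\<close>, so that \<open>x\<close> is a loop at \<open>0\<close> with \<open>x' = - v\<close>. Integrating the dynamics,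
  \<open>X\<^sub>T - X\<^sub>0 = S\<^sub>0 \<integral> v + \<sigma> \<integral> v W - \<integral> v\<^sub>t (\<integral>\<^sub>0\<^sup>t f(|x\<^sub>s|) v\<^sub>s ds) dt - \<integral> h(t, v\<^sub>t) v\<^sub>t dt\<close>.
  The first integral is zero because \<open>x\<close> is a loop, the second has mean zero by Fubini, and the last
  one is nonnegative. By Fubini the third one equals
  \<open>\<integral> f(|x\<^sub>s|) v\<^sub>s (\<integral>\<^sub>s\<^sup>T v\<^sub>t dt) ds = - \<integral> f(|x\<^sub>s|) x\<^sub>s x'\<^sub>s ds\<close>, an integral of the form
  \<open>\<integral> F(x\<^sub>s) x'\<^sub>s ds\<close> along a loop, which vanishes even for unbounded \<open>F\<close>: it holds for continuous \<open>F\<close>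
  by the chain rule, then for indicators of half-lines, so the occupation measures of \<open>x\<close> weighted with
  the positive and the negative part of \<open>x'\<close> coincide.
\<close>

section \<open>Absolutely continuous functions have densities\<close>

text \<open>Three gaps lie between the hypotheses and this computation. Absolute continuity is given
  by \<open>\<epsilon>\<close>-\<open>\<delta>\<close> sums, while \<open>v\<close> is prescribed
  only where \<open>q\<close> is differentiable; so a density \<open>g\<close> with \<open>q\<close>
  as its integral and \<open>q' = g\<close> almost everywhere has to be produced, by Jordan
  decomposition and Radon-Nikodym for the integral, by Vitali coverings for the derivative. Second,
  \<open>f\<close> is merely Lebesgue measurable and possibly unbounded: changing \<open>f\<close>
  on a null set can change \<open>f \<bar>q 0 - q s\<bar>\<close> on a set of positive measure, and
  an antiderivative of \<open>y * f \<bar>y\<bar>\<close> is in general not Lipschitz, so its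
  composition with \<open>q\<close> is not evidently absolutely continuous. The factor
  \<open>v\<close> cures the former, a comparison of measures on the line the latter. Third,
  \<open>S\<close> and \<open>X\<close> are determined only up to null sets and \<open>W\<close> has
  continuous paths only almost surely: Fubini calls for a jointly measurable version of
  \<open>W\<close>, and measurability of \<open>X T\<close> comes from completeness of
  \<open>M\<close>.\<close>

definition interval_family :: "real set \<Rightarrow> 'i set \<Rightarrow> ('i \<Rightarrow> real) \<Rightarrow> ('i \<Rightarrow> real) \<Rightarrow> bool" where
  "interval_family I J a b \<longleftrightarrow> finite J \<and> (\<forall>i\<in>J. a i \<le> b i \<and> {a i..b i} \<subseteq> I) \<and>
     disjoint_family_on (\<lambda>i. {a i<..<b i}) J"

text \<open>Nonoverlapping families stand in for partitions: gaps only lose variation, so the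
  supremum is the usual total variation on an interval, while monotonicity in \<open>I\<close> is
  immediate and families can be cut or glued without tracking endpoints.\<close>

definition variation_sums :: "(real \<Rightarrow> real) \<Rightarrow> real set \<Rightarrow> real set" where
  "variation_sums q I = {\<Sum>i\<in>J. \<bar>q (b i) - q (a i)\<bar> | (J::nat set) a b. interval_family I J a b}"

definition total_variation :: "(real \<Rightarrow> real) \<Rightarrow> real set \<Rightarrow> real" where
  "total_variation q I = Sup (variation_sums q I)"

lemma variation_sumsI:
  fixes J :: "nat set"
  assumes "interval_family I J a b"
  shows "(\<Sum>i\<in>J. \<bar>q (b i) - q (a i)\<bar>) \<in> variation_sums q I"
  using assms unfolding variation_sums_def by blast

lemma interval_family_mono: "interval_family I J a b \<Longrightarrow> I \<subseteq> I' \<Longrightarrow> interval_family I' J a b"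
  unfolding interval_family_def by blast

lemma variation_sums_mono: "I \<subseteq> I' \<Longrightarrow> variation_sums q I \<subseteq> variation_sums q I'"
  unfolding variation_sums_def using interval_family_mono by blast

lemma interval_family_reindex:
  assumes "interval_family I J a b" "bij_betw h K J"
  shows "interval_family I K (a \<circ> h) (b \<circ> h)"
proof -
  have "finite K" using assms bij_betw_finite unfolding interval_family_def by blast
  moreover have "\<forall>i\<in>K. (a \<circ> h) i \<le> (b \<circ> h) i \<and> {(a \<circ> h) i..(b \<circ> h) i} \<subseteq> I"
    using assms unfolding interval_family_def by (auto simp: bij_betw_def)
  moreover have "disjoint_family_on (\<lambda>i. {(a \<circ> h) i<..<(b \<circ> h) i}) K"
    unfolding disjoint_family_on_def
  proof (intro ballI impI)
    fix m n assume mn: "m \<in> K" "n \<in> K" "m \<noteq> n"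
    then have "h m \<in> J" "h n \<in> J" "h m \<noteq> h n"
      using assms(2) by (auto simp: bij_betw_def inj_on_def)
    then show "{(a \<circ> h) m<..<(b \<circ> h) m} \<inter> {(a \<circ> h) n<..<(b \<circ> h) n} = {}"
      using assms(1) unfolding interval_family_def disjoint_family_on_def by auto
  qed
  ultimately show ?thesis unfolding interval_family_def by blast
qed

lemma interval_family_sum_length:
  assumes "interval_family {c..d} J a b" "c \<le> d"
  shows "(\<Sum>i\<in>J. b i - a i) \<le> d - c"
proof -
  have fin: "finite J" and ab: "\<And>i. i \<in> J \<Longrightarrow> a i \<le> b i \<and> {a i..b i} \<subseteq> {c..d}"
    and dis: "disjoint_family_on (\<lambda>i. {a i<..<b i}) J"
    using assms(1) unfolding interval_family_def by blast+
  have "(\<Sum>i\<in>J. b i - a i) = (\<Sum>i\<in>J. measure lborel {a i<..<b i})"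
    using ab by (intro sum.cong) auto
  also have "\<dots> = measure lborel (\<Union>i\<in>J. {a i<..<b i})"
    using fin dis ab by (intro measure_finite_Union[symmetric]) auto
  also have "\<dots> \<le> measure lborel {c..d}"
  proof (rule measure_mono_fmeasurable)
    show "(\<Union>i\<in>J. {a i<..<b i}) \<subseteq> {c..d}"
    proof
      fix x assume "x \<in> (\<Union>i\<in>J. {a i<..<b i})"
      then obtain i where "i \<in> J" "x \<in> {a i<..<b i}" by blast
      then show "x \<in> {c..d}" using ab[of i] by (auto simp: subset_iff)
    qed
    show "(\<Union>i\<in>J. {a i<..<b i}) \<in> sets lborel" using fin by auto
    show "{c..d} \<in> fmeasurable lborel"
      by (simp add: fmeasurable_def emeasure_lborel_Icc_eq)
  qed
  finally show ?thesis using assms(2) by simp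
qed

text \<open>Reindexing frees the definition from \<open>{..<n}\<close>. The index type is used at
  \<open>nat\<close> for variation sums, at pairs for families of families, and at
  \<open>real set\<close> for the members of a division.\<close>

lemma absolutely_continuous_fun_on_family:
  fixes q :: "real \<Rightarrow> real"
  assumes ac: "absolutely_continuous_fun_on I q" and "\<epsilon> > 0"
  shows "\<exists>\<delta>>0. \<forall>(J::'i set) a b. interval_family I J a b \<longrightarrow> (\<Sum>i\<in>J. b i - a i) < \<delta> \<longrightarrow>
     (\<Sum>i\<in>J. \<bar>q (b i) - q (a i)\<bar>) < \<epsilon>"
proof -
  obtain \<delta> where \<delta>: "\<delta> > 0" and D: "\<And>(n::nat) a b. (\<forall>i<n. a i \<le> b i \<and> {a i..b i} \<subseteq> I) \<Longrightarrow>
      disjoint_family_on (\<lambda>i. {a i<..<b i}) {..<n} \<Longrightarrow>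
      (\<Sum>i<n. b i - a i) < \<delta> \<Longrightarrow> (\<Sum>i<n. \<bar>q (b i) - q (a i)\<bar>) < \<epsilon>"
    using ac \<open>\<epsilon> > 0\<close> unfolding absolutely_continuous_fun_on_def by blast
  have "(\<Sum>i\<in>J. \<bar>q (b i) - q (a i)\<bar>) < \<epsilon>"
    if fam: "interval_family I J a b" and len: "(\<Sum>i\<in>J. b i - a i) < \<delta>" for J :: "'i set" and a b
  proof -
    obtain h where h: "bij_betw h {..<card J} J"
      using fam ex_bij_betw_nat_finite[of J] unfolding interval_family_def
      by (auto simp: atLeast0LessThan)
    note fam' = interval_family_reindex[OF fam h]
    have "(\<Sum>i<card J. \<bar>q ((b \<circ> h) i) - q ((a \<circ> h) i)\<bar>) < \<epsilon>"
    proof (rule D)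
      show "\<forall>i<card J. (a \<circ> h) i \<le> (b \<circ> h) i \<and> {(a \<circ> h) i..(b \<circ> h) i} \<subseteq> I"
        and "disjoint_family_on (\<lambda>i. {(a \<circ> h) i<..<(b \<circ> h) i}) {..<card J}"
        using fam' unfolding interval_family_def by auto
      show "(\<Sum>i<card J. (b \<circ> h) i - (a \<circ> h) i) < \<delta>"
        using len sum.reindex_bij_betw[OF h, of "\<lambda>i. b i - a i"] by simp
    qed
    then show ?thesis
      using sum.reindex_bij_betw[OF h, of "\<lambda>i. \<bar>q (b i) - q (a i)\<bar>"] by simp
  qed
  then show ?thesis using \<delta> by blast
qed

text \<open>Each interval is cut at \<open>b\<close>; for those that straddle \<open>b\<close> the
  triangle inequality through \<open>q b\<close> gives the bound.\<close>

lemma variation_sums_split: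
  assumes "s \<in> variation_sums q {a..c}" "a \<le> b" "b \<le> c"
  obtains s1 s2 where "s1 \<in> variation_sums q {a..b}" "s2 \<in> variation_sums q {b..c}"
    "s \<le> s1 + s2"
proof -
  obtain J :: "nat set" and l r where s: "s = (\<Sum>i\<in>J. \<bar>q (r i) - q (l i)\<bar>)"
    and fam: "interval_family {a..c} J l r"
    using assms(1) unfolding variation_sums_def by blast
  have fin: "finite J" and lr: "\<And>i. i \<in> J \<Longrightarrow> l i \<le> r i \<and> {l i..r i} \<subseteq> {a..c}"
    and dis: "\<And>i j. i \<in> J \<Longrightarrow> j \<in> J \<Longrightarrow> i \<noteq> j \<Longrightarrow> {l i<..<r i} \<inter> {l j<..<r j} = {}"
    using fam unfolding interval_family_def disjoint_family_on_def by blast+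
  have mem: "a \<le> l i" "r i \<le> c" "l i \<le> r i" if "i \<in> J" for i
    using lr[OF that] by auto
  \<comment> \<open>Clamping keeps the index set: an interval to the right of \<open>b\<close>
    collapses to \<open>{b..b}\<close> and contributes zero.\<close>
  have 1: "interval_family {a..b} J (\<lambda>i. min (l i) b) (\<lambda>i. min (r i) b)"
    unfolding interval_family_def disjoint_family_on_def
  proof (intro conjI ballI impI fin)
    fix i assume i: "i \<in> J"
    show "min (l i) b \<le> min (r i) b" using lr[OF i] by auto
    show "{min (l i) b..min (r i) b} \<subseteq> {a..b}"
      using mem[OF i] assms(2) by auto
  next
    fix i j assume "i \<in> J" "j \<in> J" "i \<noteq> j"
    from dis[OF this] show "{min (l i) b<..<min (r i) b} \<inter> {min (l j) b<..<min (r j) b} = {}"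
      by (fastforce simp: disjoint_iff)
  qed
  have 2: "interval_family {b..c} J (\<lambda>i. max (l i) b) (\<lambda>i. max (r i) b)"
    unfolding interval_family_def disjoint_family_on_def
  proof (intro conjI ballI impI fin)
    fix i assume i: "i \<in> J"
    show "max (l i) b \<le> max (r i) b" using lr[OF i] by auto
    show "{max (l i) b..max (r i) b} \<subseteq> {b..c}"
      using mem[OF i] assms(3) by auto
  next
    fix i j assume "i \<in> J" "j \<in> J" "i \<noteq> j"
    from dis[OF this] show "{max (l i) b<..<max (r i) b} \<inter> {max (l j) b<..<max (r j) b} = {}"
      by (fastforce simp: disjoint_iff)
  qed
  have *: "\<bar>q (r i) - q (l i)\<bar> \<le>
      \<bar>q (min (r i) b) - q (min (l i) b)\<bar> + \<bar>q (max (r i) b) - q (max (l i) b)\<bar>" for i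
    by (auto simp: min_def max_def)
  have "s \<le> (\<Sum>i\<in>J. \<bar>q (min (r i) b) - q (min (l i) b)\<bar>) +
      (\<Sum>i\<in>J. \<bar>q (max (r i) b) - q (max (l i) b)\<bar>)"
    unfolding s sum.distrib[symmetric] by (intro sum_mono *)
  moreover have "(\<Sum>i\<in>J. \<bar>q (min (r i) b) - q (min (l i) b)\<bar>) \<in> variation_sums q {a..b}"
    "(\<Sum>i\<in>J. \<bar>q (max (r i) b) - q (max (l i) b)\<bar>) \<in> variation_sums q {b..c}"
    using variation_sumsI[OF 1] variation_sumsI[OF 2] by simp_all
  ultimately show thesis using that by blast
qed

lemma zero_in_variation_sums: "0 \<in> variation_sums q I"
proof -
  have "interval_family I ({}::nat set) (\<lambda>_. 0) (\<lambda>_. 0)"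
    by (simp add: interval_family_def disjoint_family_on_def)
  then show ?thesis unfolding variation_sums_def by force
qed

text \<open>A fresh index \<open>k\<close> carries the extra interval \<open>{b..c}\<close>; open
  intervals on different sides of \<open>b\<close> stay disjoint.\<close>

lemma variation_sums_append:
  assumes "s \<in> variation_sums q {a..b}" "a \<le> b" "b \<le> c"
  shows "s + \<bar>q c - q b\<bar> \<in> variation_sums q {a..c}"
proof -
  obtain J :: "nat set" and l r where s: "s = (\<Sum>i\<in>J. \<bar>q (r i) - q (l i)\<bar>)"
    and fam: "interval_family {a..b} J l r"
    using assms(1) unfolding variation_sums_def by blast
  have fin: "finite J" and lr: "\<And>i. i \<in> J \<Longrightarrow> l i \<le> r i \<and> {l i..r i} \<subseteq> {a..b}"
    and dis: "\<And>i j. i \<in> J \<Longrightarrow> j \<in> J \<Longrightarrow> i \<noteq> j \<Longrightarrow> {l i<..<r i} \<inter> {l j<..<r j} = {}"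
    using fam unfolding interval_family_def disjoint_family_on_def by blast+
  obtain k where k: "k \<notin> J" using fin ex_new_if_finite infinite_UNIV_nat by blast
  have mem: "a \<le> l i" "r i \<le> b" if "i \<in> J" for i
    using lr[OF that] by auto
  have "interval_family {a..c} (insert k J) (l(k := b)) (r(k := c))"
    unfolding interval_family_def disjoint_family_on_def
  proof (intro conjI ballI impI)
    show "finite (insert k J)" using fin by simp
  next
    fix i assume i: "i \<in> insert k J"
    show "(l(k := b)) i \<le> (r(k := c)) i" using i lr assms by auto
    show "{(l(k := b)) i..(r(k := c)) i} \<subseteq> {a..c}" using i mem[of i] k assms by auto
  next
    fix i j assume ij: "i \<in> insert k J" "j \<in> insert k J" "i \<noteq> j"
    show "{(l(k := b)) i<..<(r(k := c)) i} \<inter> {(l(k := b)) j<..<(r(k := c)) j} = {}"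
    proof (cases "i = k \<or> j = k")
      case True
      then show ?thesis using ij mem[of i] mem[of j] by (auto simp: disjoint_iff)
    next
      case False
      then show ?thesis using ij dis[of i j] by auto
    qed
  qed
  moreover have "s + \<bar>q c - q b\<bar> = (\<Sum>i\<in>insert k J. \<bar>q ((r(k := c)) i) - q ((l(k := b)) i)\<bar>)"
    using fin k by (simp add: s) (intro sum.cong, auto)
  ultimately show ?thesis unfolding variation_sums_def by blast
qed

text \<open>With \<open>\<epsilon> = 1\<close>, variation sums over an interval shorter than
  \<open>\<delta>\<close> are at most 1; bisection adds finitely many such bounds through
  \<open>variation_sums_split\<close>.\<close>

lemma absolutely_continuous_bdd_variation:
  assumes ac: "absolutely_continuous_fun_on {c..d} q" and "c \<le> d"
  shows "bdd_above (variation_sums q {c..d})"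
proof -
  obtain \<delta> where \<delta>: "\<delta> > 0" and D: "\<And>(J::nat set) a b. interval_family {c..d} J a b \<Longrightarrow>
     (\<Sum>i\<in>J. b i - a i) < \<delta> \<Longrightarrow> (\<Sum>i\<in>J. \<bar>q (b i) - q (a i)\<bar>) < 1"
    using absolutely_continuous_fun_on_family[OF ac, of 1, where 'i=nat] by auto
  \<comment> \<open>The bounds \<open>c \<le> a\<close> and \<open>b \<le> d\<close> sit inside
    \<open>P\<close> because the local step of \<open>Bolzano\<close> ranges over intervals that may
    stick out of \<open>{c..d}\<close>.\<close>
  define P where "P a b \<longleftrightarrow> (c \<le> a \<longrightarrow> b \<le> d \<longrightarrow> bdd_above (variation_sums q {a..b}))" for a b
  from \<open>c \<le> d\<close> have "P c d"
  proof (induction rule: Bolzano)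
    case (trans a b e)
    show ?case unfolding P_def
    proof (intro impI)
      assume "c \<le> a" "e \<le> d"
      then have "bdd_above (variation_sums q {a..b})" "bdd_above (variation_sums q {b..e})"
        using trans unfolding P_def by auto
      then obtain B1 B2 where B: "\<And>s. s \<in> variation_sums q {a..b} \<Longrightarrow> s \<le> B1"
          "\<And>s. s \<in> variation_sums q {b..e} \<Longrightarrow> s \<le> B2"
        unfolding bdd_above_def by blast
      show "bdd_above (variation_sums q {a..e})"
      proof (rule bdd_aboveI[of _ "B1 + B2"])
        fix s assume "s \<in> variation_sums q {a..e}"
        then obtain s1 s2 where "s1 \<in> variation_sums q {a..b}" "s2 \<in> variation_sums q {b..e}" "s \<le> s1 + s2"
          by (rule variation_sums_split[OF _ trans(3,4)])
        with B(1)[OF this(1)] B(2)[OF this(2)] show "s \<le> B1 + B2" by linarith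
      qed
    qed
  next
    case (local x)
    have "P a b" if "a \<le> x" "x \<le> b" "b - a < \<delta>" for a b
      unfolding P_def
    proof (intro impI bdd_aboveI[of _ 1])
      fix s assume cd: "c \<le> a" "b \<le> d" and "s \<in> variation_sums q {a..b}"
      then obtain J :: "nat set" and l r where s: "s = (\<Sum>i\<in>J. \<bar>q (r i) - q (l i)\<bar>)"
        and fam: "interval_family {a..b} J l r"
        unfolding variation_sums_def by blast
      have "interval_family {c..d} J l r"
        by (rule interval_family_mono[OF fam]) (use cd in auto)
      moreover have "(\<Sum>i\<in>J. r i - l i) < \<delta>"
        using interval_family_sum_length[OF fam] that by auto
      ultimately show "s \<le> 1" using D[of J l r] unfolding s by simp
    qed
    with \<delta> show ?case by (intro exI[of _ \<delta>]) blast
  qed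
  then show ?thesis by (simp add: P_def)
qed

section \<open>Total variation as a function of the interval\<close>

lemma total_variation_upper:
  "s \<in> variation_sums q I \<Longrightarrow> bdd_above (variation_sums q I) \<Longrightarrow> s \<le> total_variation q I"
  unfolding total_variation_def by (rule cSup_upper)

text \<open>The inequality that makes both \<open>V\<close> and \<open>V - q\<close> nondecreasing
  for the running variation \<open>V\<close>.\<close>

lemma total_variation_append:
  assumes "bdd_above (variation_sums q {a..c})" "a \<le> b" "b \<le> c"
  shows "total_variation q {a..b} + \<bar>q c - q b\<bar> \<le> total_variation q {a..c}"
proof -
  have "total_variation q {a..b} \<le> total_variation q {a..c} - \<bar>q c - q b\<bar>"
    unfolding total_variation_def[of q "{a..b}"]
  proof (rule cSup_least)
    show "variation_sums q {a..b} \<noteq> {}" using zero_in_variation_sums by blast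
    fix s assume "s \<in> variation_sums q {a..b}"
    from total_variation_upper[OF variation_sums_append[OF this assms(2,3)] assms(1)]
    show "s \<le> total_variation q {a..c} - \<bar>q c - q b\<bar>" by simp
  qed
  then show ?thesis by simp
qed

lemma total_variation_split:
  assumes bdd: "bdd_above (variation_sums q {a..c})" and "a \<le> b" "b \<le> c"
  shows "total_variation q {a..c} \<le> total_variation q {a..b} + total_variation q {b..c}"
  unfolding total_variation_def[of q "{a..c}"]
proof (rule cSup_least)
  show "variation_sums q {a..c} \<noteq> {}" using zero_in_variation_sums by blast
  have bdd': "bdd_above (variation_sums q {a..b})" "bdd_above (variation_sums q {b..c})"
    using assms by (auto intro!: bdd_above_mono[OF bdd] variation_sums_mono)
  fix s assume "s \<in> variation_sums q {a..c}"
  from variation_sums_split[OF this assms(2,3)]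
  show "s \<le> total_variation q {a..b} + total_variation q {b..c}"
    using total_variation_upper bdd' by (smt (verit, best))
qed

text \<open>By \<open>total_variation_split\<close>, the increment of the running variation over
  \<open>{a i..b i}\<close> is at most the variation of \<open>q\<close> there, which a finite
  family inside that interval nearly attains. All these families together have length below
  \<open>\<delta>\<close>, so absolute continuity of \<open>q\<close> bounds the increments at
  once.\<close>

lemma absolutely_continuous_fun_on_total_variation:
  assumes ac: "absolutely_continuous_fun_on {c..d} q"
  shows "absolutely_continuous_fun_on {c..d} (\<lambda>t. total_variation q {c..t})"
  unfolding absolutely_continuous_fun_on_def
proof (intro allI impI)
  fix \<epsilon> :: real assume "\<epsilon> > 0"
  then have "\<epsilon> / 3 > 0" by simp
  from absolutely_continuous_fun_on_family[OF ac this, where 'i="nat \<times> nat"]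
  obtain \<delta> where \<delta>: "\<delta> > 0" and D: "\<And>(J::(nat \<times> nat) set) a b. interval_family {c..d} J a b \<Longrightarrow>
     (\<Sum>i\<in>J. b i - a i) < \<delta> \<Longrightarrow> (\<Sum>i\<in>J. \<bar>q (b i) - q (a i)\<bar>) < \<epsilon> / 3" by blast
  have *: "(\<Sum>i<n. \<bar>total_variation q {c..b i} - total_variation q {c..a i}\<bar>) < \<epsilon>"
    if ab: "\<forall>i<n. a i \<le> b i \<and> {a i..b i} \<subseteq> {c..d}"
      and dis: "disjoint_family_on (\<lambda>i. {a i<..<b i}) {..<n}"
      and len: "(\<Sum>i<n. b i - a i) < \<delta>" for n :: nat and a b
  proof -
    \<comment> \<open>The \<open>n\<close> approximation errors then add up to less than
      \<open>\<epsilon> / 3\<close>; the added 1 covers \<open>n = 0\<close>.\<close>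
    define \<eta> where "\<eta> = \<epsilon> / (3 * (real n + 1))"
    have \<eta>: "\<eta> > 0" using \<open>\<epsilon> > 0\<close> by (simp add: \<eta>_def)
    have mem: "c \<le> a i" "a i \<le> b i" "b i \<le> d" if "i < n" for i
      using ab that by auto
    define Q where "Q i J l r \<longleftrightarrow> interval_family {a i..b i} (J::nat set) l r \<and>
      \<bar>total_variation q {c..b i} - total_variation q {c..a i}\<bar> \<le> (\<Sum>j\<in>J. \<bar>q (r j) - q (l j)\<bar>) + \<eta>"
      for i J l r
    have "\<exists>J l r. Q i J l r" if i: "i < n" for i
    proof -
      have bdd: "bdd_above (variation_sums q {c..d})"
        using absolutely_continuous_bdd_variation[OF ac] mem[OF i] by simp
      have bdd1: "bdd_above (variation_sums q {c..b i})"
        using mem[OF i] by (auto intro!: bdd_above_mono[OF bdd] variation_sums_mono)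
      have "total_variation q {a i..b i} - \<eta> < Sup (variation_sums q {a i..b i})"
        using \<eta> by (simp add: total_variation_def)
      then obtain s where "s \<in> variation_sums q {a i..b i}" "total_variation q {a i..b i} - \<eta> < s"
        using less_cSupD[of "variation_sums q {a i..b i}"] zero_in_variation_sums by blast
      then show ?thesis
        using total_variation_split[OF bdd1 mem(1,2)[OF i]]
          total_variation_append[OF bdd1 mem(1,2)[OF i]]
        unfolding variation_sums_def Q_def by force
    qed
    then obtain J l r where Q: "\<And>i. i < n \<Longrightarrow> Q i (J i) (l i) (r i)" by metis
    have fam: "\<And>i. i < n \<Longrightarrow> interval_family {a i..b i} (J i::nat set) (l i) (r i)"
      and le: "\<And>i. i < n \<Longrightarrow> \<bar>total_variation q {c..b i} - total_variation q {c..a i}\<bar>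
          \<le> (\<Sum>j\<in>J i. \<bar>q (r i j) - q (l i j)\<bar>) + \<eta>"
      using Q unfolding Q_def by blast+
    have finJ: "finite (J i)" if "i < n" for i using fam[OF that] by (simp add: interval_family_def)
    have lr: "a i \<le> l i j" "l i j \<le> r i j" "r i j \<le> b i" if "i < n" "j \<in> J i" for i j
      using fam[OF that(1)] that(2) unfolding interval_family_def by auto
    let ?K = "SIGMA i:{..<n}. J i"
    have "interval_family {c..d} ?K (\<lambda>(i, j). l i j) (\<lambda>(i, j). r i j)"
      unfolding interval_family_def
    proof (intro conjI ballI)
      show "finite ?K" using finJ by auto
      fix k assume "k \<in> ?K"
      then obtain i j where "k = (i, j)" "i < n" "j \<in> J i" by blast
      with lr[OF this(2,3)] mem[OF this(2)] show "(case k of (i, j) \<Rightarrow> l i j) \<le> (case k of (i, j) \<Rightarrow> r i j)"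
        "{case k of (i, j) \<Rightarrow> l i j..case k of (i, j) \<Rightarrow> r i j} \<subseteq> {c..d}"
        by auto
    next
      have "{l i j<..<r i j} \<inter> {l i' j'<..<r i' j'} = {}"
        if "i < n" "j \<in> J i" "i' < n" "j' \<in> J i'" "(i, j) \<noteq> (i', j')" for i j i' j'
      proof (cases "i = i'")
        case True
        then show ?thesis using fam[of i] that
          unfolding interval_family_def disjoint_family_on_def by auto
      next
        case False
        then have "{a i<..<b i} \<inter> {a i'<..<b i'} = {}"
          using dis that unfolding disjoint_family_on_def by auto
        moreover have "{l i j<..<r i j} \<subseteq> {a i<..<b i}" "{l i' j'<..<r i' j'} \<subseteq> {a i'<..<b i'}"
          using lr(1,3)[OF that(1,2)] lr(1,3)[OF that(3,4)] by auto
        ultimately show ?thesis by blast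
      qed
      then show "disjoint_family_on (\<lambda>k. {case k of (i, j) \<Rightarrow> l i j<..<case k of (i, j) \<Rightarrow> r i j}) ?K"
        unfolding disjoint_family_on_def by auto
    qed
    moreover have "(\<Sum>k\<in>?K. (case k of (i, j) \<Rightarrow> r i j) - (case k of (i, j) \<Rightarrow> l i j)) < \<delta>"
    proof -
      have "(\<Sum>k\<in>?K. (case k of (i, j) \<Rightarrow> r i j) - (case k of (i, j) \<Rightarrow> l i j))
          = (\<Sum>i<n. \<Sum>j\<in>J i. r i j - l i j)"
        using finJ by (subst sum.Sigma) (auto intro!: sum.cong)
      also have "\<dots> \<le> (\<Sum>i<n. b i - a i)"
        using interval_family_sum_length[OF fam] mem by (intro sum_mono) auto
      finally show ?thesis using len by simp
    qed
    ultimately have "(\<Sum>k\<in>?K. \<bar>q (case k of (i, j) \<Rightarrow> r i j) - q (case k of (i, j) \<Rightarrow> l i j)\<bar>) < \<epsilon> / 3"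
      by (rule D)
    also have "(\<Sum>k\<in>?K. \<bar>q (case k of (i, j) \<Rightarrow> r i j) - q (case k of (i, j) \<Rightarrow> l i j)\<bar>) =
        (\<Sum>i<n. \<Sum>j\<in>J i. \<bar>q (r i j) - q (l i j)\<bar>)"
      using finJ by (subst sum.Sigma) (auto intro!: sum.cong)
    finally have "(\<Sum>i<n. (\<Sum>j\<in>J i. \<bar>q (r i j) - q (l i j)\<bar>) + \<eta>) < \<epsilon> / 3 + real n * \<eta>"
      by (simp add: sum.distrib)
    moreover have "real n * \<eta> < \<epsilon> / 3"
      using \<open>\<epsilon> > 0\<close> by (simp add: \<eta>_def field_simps)
    moreover have "(\<Sum>i<n. \<bar>total_variation q {c..b i} - total_variation q {c..a i}\<bar>)
        \<le> (\<Sum>i<n. (\<Sum>j\<in>J i. \<bar>q (r i j) - q (l i j)\<bar>) + \<eta>)"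
      by (intro sum_mono le) simp
    ultimately show ?thesis using \<open>\<epsilon> > 0\<close> by linarith
  qed
  show "\<exists>\<delta>>0. \<forall>(n::nat) a b. (\<forall>i<n. a i \<le> b i \<and> {a i..b i} \<subseteq> {c..d}) \<longrightarrow>
      disjoint_family_on (\<lambda>i. {a i<..<b i}) {..<n} \<longrightarrow> (\<Sum>i<n. b i - a i) < \<delta> \<longrightarrow>
      (\<Sum>i<n. \<bar>total_variation q {c..b i} - total_variation q {c..a i}\<bar>) < \<epsilon>"
  proof (intro exI[of _ \<delta>] conjI allI impI)
    show "\<delta> > 0" by fact
  next
    fix n :: nat and a b
    assume "\<forall>i<n. a i \<le> b i \<and> {a i..b i} \<subseteq> {c..d}"
      "disjoint_family_on (\<lambda>i. {a i<..<b i}) {..<n}" "(\<Sum>i<n. b i - a i) < \<delta>"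
    then show "(\<Sum>i<n. \<bar>total_variation q {c..b i} - total_variation q {c..a i}\<bar>) < \<epsilon>"
      by (rule *)
  qed
qed

section \<open>Stieltjes measures of monotone absolutely continuous functions\<close>

lemma absolutely_continuous_fun_on_imp_continuous_on:
  assumes ac: "absolutely_continuous_fun_on {c..d} q"
  shows "continuous_on {c..d} q"
  unfolding continuous_on_iff
proof (intro ballI allI impI)
  fix x e :: real assume x: "x \<in> {c..d}" and "e > 0"
  then obtain \<delta> where \<delta>: "\<delta> > 0" and D: "\<And>(n::nat) a b. (\<forall>i<n. a i \<le> b i \<and> {a i..b i} \<subseteq> {c..d}) \<Longrightarrow>
      disjoint_family_on (\<lambda>i. {a i<..<b i}) {..<n} \<Longrightarrow>
      (\<Sum>i<n. b i - a i) < \<delta> \<Longrightarrow> (\<Sum>i<n. \<bar>q (b i) - q (a i)\<bar>) < e"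
    using ac unfolding absolutely_continuous_fun_on_def by blast
  have "dist (q y) (q x) < e" if y: "y \<in> {c..d}" "dist y x < \<delta>" for y
  proof (cases "x \<le> y")
    case True
    then show ?thesis using D[of 1 "\<lambda>_. x" "\<lambda>_. y"] x y
      by (auto simp: dist_real_def disjoint_family_on_def)
  next
    case False
    then show ?thesis using D[of 1 "\<lambda>_. y" "\<lambda>_. x"] x y
      by (auto simp: dist_real_def disjoint_family_on_def)
  qed
  then show "\<exists>\<delta>>0. \<forall>y\<in>{c..d}. dist y x < \<delta> \<longrightarrow> dist (q y) (q x) < e"
    using \<delta> by blast
qed

text \<open>An open set is an increasing limit of finite unions of closed intervals. Each finite
  union divides into nonoverlapping intervals of total length below \<open>\<delta>\<close>, whose
  Stieltjes mass is bounded by a variation sum of \<open>V\<close>; the bound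
  \<open>\<epsilon>\<close> survives the limit.\<close>

lemma emeasure_interval_measure_open_le:
  assumes ac: "absolutely_continuous_fun_on {c..d} V" and mono: "mono_on {c..d} V" and "c \<le> d"
    and \<delta>: "\<And>(J::real set set) a b. interval_family {c..d} J a b \<Longrightarrow>
     (\<Sum>i\<in>J. b i - a i) < \<delta> \<Longrightarrow> (\<Sum>i\<in>J. \<bar>V (b i) - V (a i)\<bar>) < \<epsilon>"
    and U: "open U" "emeasure lborel U < ennreal \<delta>" and "\<epsilon> > 0"
    and F: "F = (\<lambda>t. V (max c (min d t)))"
  shows "emeasure (interval_measure F) U \<le> ennreal \<epsilon>"
proof -
  let ?\<mu> = "interval_measure F" and ?cl = "\<lambda>t. max c (min d t)"
  have F_mono: "F x \<le> F y" if "x \<le> y" for x y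
    using mono that \<open>c \<le> d\<close> unfolding F by (intro mono_onD[OF mono]) auto
  have F_cont: "continuous_on UNIV F" unfolding F
    using \<open>c \<le> d\<close> by (intro continuous_on_compose2[OF absolutely_continuous_fun_on_imp_continuous_on[OF ac]])
       (auto intro!: continuous_intros)
  have \<mu>_Icc: "emeasure ?\<mu> {a..b} = ennreal (F b - F a)" if "a \<le> b" for a b
    by (rule emeasure_interval_measure_Icc[OF that F_mono F_cont])
  have fin: "emeasure ?\<mu> (\<Union>\<F>) \<le> ennreal \<epsilon>"
    if \<F>: "finite \<F>" "\<F> \<subseteq> Pow U" "\<And>X. X \<in> \<F> \<Longrightarrow> \<exists>a b. X = cbox a b" for \<F>
  proof -
    \<comment> \<open>The members of the division serve as their own indices: nonempty closed
      intervals, recovered from \<open>Inf\<close> and \<open>Sup\<close>, with disjoint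
      interiors.\<close>
    obtain p where p: "p division_of (\<Union>\<F>)"
      using elementary_unions_intervals[OF \<F>(1)] \<F>(3) by metis
    have K: "K \<subseteq> U" "K = {Inf K..Sup K}" "Inf K \<le> Sup K" "interior K = {Inf K<..<Sup K}" if k: "K \<in> p" for K
    proof -
      obtain a b where ab: "K = cbox a b" using division_ofD(4)[OF p k] by blast
      have ne: "K \<noteq> {}" using division_ofD(3)[OF p k] .
      show "K \<subseteq> U" using division_ofD(2)[OF p k] \<F>(2) by blast
      have "a \<le> b" using ne ab by simp
      then show "K = {Inf K..Sup K}" "Inf K \<le> Sup K" "interior K = {Inf K<..<Sup K}"
        using ab by (auto simp: interior_atLeastAtMost_real)
    qed
    have K_borel: "K \<in> sets borel" if "K \<in> p" for K
      using division_ofD(4)[OF p that] by fastforce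
    have finp: "finite p" using p by blast
    have disj: "{Inf K<..<Sup K} \<inter> {Inf L<..<Sup L} = {}" if "K \<in> p" "L \<in> p" "K \<noteq> L" for K L
      using division_ofD(5)[OF p that] K(4) that by auto
    have "(\<Sum>K\<in>p. ennreal (Sup K - Inf K)) = (\<Sum>K\<in>p. emeasure lborel {Inf K<..<Sup K})"
      using K(3) by (intro sum.cong) auto
    also have "\<dots> = emeasure lborel (\<Union>K\<in>p. {Inf K<..<Sup K})"
      using finp disj by (intro sum_emeasure) (auto simp: disjoint_family_on_def)
    also have "\<dots> \<le> emeasure lborel U"
    proof (rule emeasure_mono)
      show "(\<Union>K\<in>p. {Inf K<..<Sup K}) \<subseteq> U"
        using K(1,4) interior_subset by blast
    qed (use U in auto)
    also note U(2)
    finally have "ennreal (\<Sum>K\<in>p. Sup K - Inf K) < ennreal \<delta>"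
      using K(3) by (subst sum_ennreal[symmetric]) auto
    then have len: "(\<Sum>K\<in>p. Sup K - Inf K) < \<delta>"
      by (metis ennreal_leI not_le)
    \<comment> \<open>Clamping to \<open>{c..d}\<close> matches the constant extension in
      \<open>F\<close> and never lengthens an interval, so the family stays nonoverlapping and
      short.\<close>
    have "(\<Sum>K\<in>p. \<bar>V (?cl (Sup K)) - V (?cl (Inf K))\<bar>) < \<epsilon>"
    proof (rule \<delta>)
      show "interval_family {c..d} p (\<lambda>K. ?cl (Inf K)) (\<lambda>K. ?cl (Sup K))"
        unfolding interval_family_def disjoint_family_on_def
      proof (intro conjI ballI impI finp)
        fix K L assume "K \<in> p" "L \<in> p" "K \<noteq> L"
        have "{?cl (Inf K)<..<?cl (Sup K)} \<subseteq> {Inf K<..<Sup K}" for K :: "real set"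
          by (auto simp: max_def min_def split: if_splits)
        with disj[OF \<open>K \<in> p\<close> \<open>L \<in> p\<close> \<open>K \<noteq> L\<close>]
        show "{?cl (Inf K)<..<?cl (Sup K)} \<inter> {?cl (Inf L)<..<?cl (Sup L)} = {}" by blast
      next
        fix K assume "K \<in> p"
        with K(3) show "?cl (Inf K) \<le> ?cl (Sup K)" by (fastforce simp: max_def min_def)
        show "{?cl (Inf K)..?cl (Sup K)} \<subseteq> {c..d}" using \<open>c \<le> d\<close> by auto
      qed
      have "?cl (Sup K) - ?cl (Inf K) \<le> Sup K - Inf K" if "K \<in> p" for K
        using K(3)[OF that] by (auto simp: max_def min_def)
      then have "(\<Sum>K\<in>p. ?cl (Sup K) - ?cl (Inf K)) \<le> (\<Sum>K\<in>p. Sup K - Inf K)"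
        by (rule sum_mono)
      with len show "(\<Sum>K\<in>p. ?cl (Sup K) - ?cl (Inf K)) < \<delta>" by linarith
    qed
    moreover have "\<bar>V (?cl (Sup K)) - V (?cl (Inf K))\<bar> = F (Sup K) - F (Inf K)" if "K \<in> p" for K
      using F_mono[OF K(3)[OF that]] unfolding F by simp
    ultimately have *: "(\<Sum>K\<in>p. F (Sup K) - F (Inf K)) < \<epsilon>" by simp
    \<comment> \<open>Neighbouring members may share endpoints, so only subadditivity is
      invoked.\<close>
    have "emeasure ?\<mu> (\<Union>\<F>) = emeasure ?\<mu> (\<Union>K\<in>p. K)"
      using division_ofD(6)[OF p] by simp
    also have "\<dots> \<le> (\<Sum>K\<in>p. emeasure ?\<mu> K)"
      using finp K_borel by (intro emeasure_subadditive_finite) auto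
    also have "\<dots> = (\<Sum>K\<in>p. ennreal (F (Sup K) - F (Inf K)))"
    proof (rule sum.cong[OF refl])
      fix K assume "K \<in> p"
      show "emeasure ?\<mu> K = ennreal (F (Sup K) - F (Inf K))"
        by (rule trans[OF arg_cong[where f = "emeasure ?\<mu>", OF K(2)[OF \<open>K \<in> p\<close>]]
            \<mu>_Icc[OF K(3)[OF \<open>K \<in> p\<close>]]])
    qed
    also have "\<dots> = ennreal (\<Sum>K\<in>p. F (Sup K) - F (Inf K))"
      using F_mono[OF K(3)] by (intro sum_ennreal) auto
    also have "\<dots> \<le> ennreal \<epsilon>" using * by (intro ennreal_leI) simp
    finally show ?thesis .
  qed
  obtain \<D> where \<D>: "countable \<D>" "\<D> \<subseteq> Pow U" "\<And>X. X \<in> \<D> \<Longrightarrow> \<exists>a b. X = cbox a b" "\<Union>\<D> = U"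
    using open_countable_Union_open_cbox[OF U(1)] by metis
  show ?thesis
  proof (cases "\<D> = {}")
    case True
    then show ?thesis using \<D>(4) by auto
  next
    case False
    let ?A = "\<lambda>n. \<Union>(from_nat_into \<D> ` {..<n})"
    have r: "range (from_nat_into \<D>) = \<D>"
      using range_from_nat_into[OF False \<D>(1)] .
    have mem: "from_nat_into \<D> i \<in> \<D>" for i using from_nat_into[OF False] .
    have U_eq: "(\<Union>n. ?A n) = U"
      using \<D>(4) r by blast
    have "(SUP n. emeasure ?\<mu> (?A n)) = emeasure ?\<mu> (\<Union>n. ?A n)"
    proof (rule SUP_emeasure_incseq)
      have "from_nat_into \<D> i \<in> sets borel" for i
        using \<D>(3)[OF mem[of i]] by fastforce
      then show "range ?A \<subseteq> sets ?\<mu>" by auto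
      show "incseq ?A" by (force simp: incseq_def)
    qed
    moreover have "emeasure ?\<mu> (?A n) \<le> ennreal \<epsilon>" for n
      using fin[of "from_nat_into \<D> ` {..<n}"] mem \<D>(2,3) by blast
    ultimately show ?thesis unfolding U_eq by (metis SUP_least)
  qed
qed

text \<open>The Lebesgue-Stieltjes measure of \<open>V\<close>, extended by constants outside \<open>{c..d}\<close>, is absolutely
  continuous as a measure, so the density is its Radon-Nikodym derivative.\<close>

lemma mono_absolutely_continuous_fun_on_density:
  assumes ac: "absolutely_continuous_fun_on {c..d} V" and mono: "mono_on {c..d} V" and "c \<le> d"
  obtains g where "g \<in> borel_measurable borel" "integrable lborel g"
    "\<And>a b. c \<le> a \<Longrightarrow> a \<le> b \<Longrightarrow> b \<le> d \<Longrightarrow> V b - V a = (LINT x:{a..b}|lborel. g x)"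
proof -
  define F where "F = (\<lambda>t. V (max c (min d t)))"
  let ?\<mu> = "interval_measure F"
  have F_mono: "F x \<le> F y" if "x \<le> y" for x y
    using mono that \<open>c \<le> d\<close> unfolding F_def by (intro mono_onD[OF mono]) auto
  have F_cont: "continuous_on UNIV F" unfolding F_def
    using \<open>c \<le> d\<close> by (intro continuous_on_compose2[OF absolutely_continuous_fun_on_imp_continuous_on[OF ac]])
       (auto intro!: continuous_intros)
  have \<mu>_Icc: "emeasure ?\<mu> {a..b} = ennreal (F b - F a)" if "a \<le> b" for a b
    by (rule emeasure_interval_measure_Icc[OF that F_mono F_cont])
  have "absolutely_continuous lborel ?\<mu>"
    unfolding absolutely_continuous_def
  proof
    fix N :: "real set" assume N: "N \<in> null_sets lborel"
    then have Nb: "N \<in> sets borel" "emeasure lborel N = 0" by auto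
    have "emeasure ?\<mu> N \<le> ennreal \<epsilon>" if "\<epsilon> > 0" for \<epsilon>
    proof -
      from absolutely_continuous_fun_on_family[OF ac that, where 'i="real set"]
      obtain \<delta> where \<delta>: "\<delta> > 0" "\<And>(J::real set set) a b. interval_family {c..d} J a b \<Longrightarrow>
        (\<Sum>i\<in>J. b i - a i) < \<delta> \<Longrightarrow> (\<Sum>i\<in>J. \<bar>V (b i) - V (a i)\<bar>) < \<epsilon>" by blast
      \<comment> \<open>Outer regularity: as \<open>N\<close> is null, all of \<open>U\<close> is as
        small as \<open>U - N\<close>, so the Stieltjes mass of \<open>N\<close> is at most every
        positive \<open>\<epsilon>\<close>.\<close>
      obtain U where U: "open U" "N \<subseteq> U" "emeasure lborel (U - N) < ennreal \<delta>"
        using outer_regular_lborel[OF Nb(1) \<delta>(1)] by blast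
      have "emeasure lborel U = emeasure lborel (U - N)"
        using N U(1) by (intro emeasure_Diff_null_set[symmetric]) auto
      with U(3) have "emeasure lborel U < ennreal \<delta>" by simp
      from emeasure_interval_measure_open_le[OF ac mono \<open>c \<le> d\<close> \<delta>(2) U(1) this that F_def]
      have "emeasure ?\<mu> U \<le> ennreal \<epsilon>" by blast
      moreover have "emeasure ?\<mu> N \<le> emeasure ?\<mu> U"
        using U(1,2) by (intro emeasure_mono) auto
      ultimately show ?thesis by order
    qed
    then have "emeasure ?\<mu> N \<le> 0 + ennreal \<epsilon>" if "\<epsilon> > 0" for \<epsilon> using that by simp
    then have "emeasure ?\<mu> N \<le> 0" by (rule ennreal_le_epsilon)
    then show "N \<in> null_sets ?\<mu>" using Nb by auto
  qed
  then obtain f where f: "f \<in> borel_measurable lborel" "density lborel f = ?\<mu>"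
    using sigma_finite_measure.Radon_Nikodym[OF sigma_finite_lborel, of ?\<mu>] by auto
  \<comment> \<open>Finite total mass makes the Radon-Nikodym derivative finite almost everywhere
    and its real version integrable; the mass is found by exhausting the line.\<close>
  have total: "emeasure ?\<mu> UNIV \<le> ennreal (V d - V c)"
  proof -
    have "(SUP n. emeasure ?\<mu> {- real n..real n}) = emeasure ?\<mu> (\<Union>n. {- real n..real n})"
      by (intro SUP_emeasure_incseq) (auto simp: incseq_def)
    also have "(\<Union>n. {- real n..real n}) = UNIV"
    proof -
      have "x \<in> (\<Union>n. {- real n..real n})" for x
        using real_arch_simple[of "\<bar>x\<bar>"] by (auto simp: abs_le_iff) (metis minus_le_iff)
      then show ?thesis by blast
    qed
    finally have "emeasure ?\<mu> UNIV = (SUP n. emeasure ?\<mu> {- real n..real n})" by simp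
    also have "\<dots> \<le> ennreal (V d - V c)"
    proof (rule SUP_least)
      fix n :: nat
      have "V c \<le> F (- real n)" "F (real n) \<le> V d"
        unfolding F_def using \<open>c \<le> d\<close> by (auto intro!: mono_onD[OF mono])
      then show "emeasure ?\<mu> {- real n..real n} \<le> ennreal (V d - V c)"
        by (subst \<mu>_Icc) (auto intro!: ennreal_leI)
    qed
    finally show ?thesis .
  qed
  have f_int: "(\<integral>\<^sup>+x. f x \<partial>lborel) = emeasure ?\<mu> UNIV"
    unfolding f(2)[symmetric] using f(1) by (subst emeasure_density) auto
  have "(\<integral>\<^sup>+x. f x \<partial>lborel) \<noteq> \<infinity>"
    using total unfolding f_int by (auto simp: top_unique)
  then have f_fin: "AE x in lborel. f x \<noteq> \<infinity>"
    using f(1) by (intro nn_integral_PInf_AE) auto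
  define g where "g x = enn2real (f x)" for x
  have g_nn: "g x \<ge> 0" for x by (simp add: g_def)
  have g_meas: "g \<in> borel_measurable borel" unfolding g_def using f(1) by auto
  have fg: "AE x in lborel. f x = ennreal (g x)"
    using f_fin by eventually_elim (simp add: g_def less_top)
  have "(\<integral>\<^sup>+x. ennreal (norm (g x)) \<partial>lborel) = (\<integral>\<^sup>+x. f x \<partial>lborel)"
    using fg by (intro nn_integral_cong_AE) (auto simp: g_def)
  then have g_int: "integrable lborel g"
    using g_meas total unfolding f_int by (intro integrableI_bounded) (auto intro: le_less_trans)
  have "V b - V a = (LINT x:{a..b}|lborel. g x)" if ab: "c \<le> a" "a \<le> b" "b \<le> d" for a b
  proof -
    have "ennreal (LINT x:{a..b}|lborel. g x) = (\<integral>\<^sup>+x. ennreal (indicator {a..b} x *\<^sub>R g x) \<partial>lborel)"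
      unfolding set_lebesgue_integral_def using g_int
      by (intro nn_integral_eq_integral[symmetric] integrable_mult_indicator) (auto simp: g_nn)
    also have "\<dots> = (\<integral>\<^sup>+x. f x * indicator {a..b} x \<partial>lborel)"
      using fg by (intro nn_integral_cong_AE) (auto simp: indicator_def)
    also have "\<dots> = emeasure ?\<mu> {a..b}"
      unfolding f(2)[symmetric] using f(1) by (subst emeasure_density) auto
    also have "\<dots> = ennreal (V b - V a)"
      using ab by (subst \<mu>_Icc) (auto simp: F_def)
    finally have "ennreal (LINT x:{a..b}|lborel. g x) = ennreal (V b - V a)" .
    moreover have "0 \<le> (LINT x:{a..b}|lborel. g x)"
      unfolding set_lebesgue_integral_def by (intro integral_nonneg_AE) (auto simp: g_def)
    moreover have "0 \<le> V b - V a" using mono_onD[OF mono, of a b] ab by auto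
    ultimately show ?thesis by simp
  qed
  with g_meas g_int show thesis by (rule that)
qed

text \<open>Jordan decomposition: \<open>q = V - (V - q)\<close> with \<open>V\<close> the running
  total variation. Both parts are nondecreasing and absolutely continuous, and their densities are
  subtracted.\<close>

theorem absolutely_continuous_fun_on_density:
  assumes ac: "absolutely_continuous_fun_on {c..d} q" and "c \<le> d"
  obtains g where "g \<in> borel_measurable borel" "integrable lborel g"
    "\<And>a b. c \<le> a \<Longrightarrow> a \<le> b \<Longrightarrow> b \<le> d \<Longrightarrow> q b - q a = (LINT x:{a..b}|lborel. g x)"
proof -
  define V where "V t = total_variation q {c..t}" for t
  have acV: "absolutely_continuous_fun_on {c..d} V"
    unfolding V_def by (rule absolutely_continuous_fun_on_total_variation[OF ac])
  have V: "V a + \<bar>q b - q a\<bar> \<le> V b" if "c \<le> a" "a \<le> b" "b \<le> d" for a b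
    unfolding V_def
    using that by (intro total_variation_append bdd_above_mono[OF absolutely_continuous_bdd_variation[OF ac \<open>c \<le> d\<close>]]
        variation_sums_mono) auto
  have monoV: "mono_on {c..d} V"
    using V by (intro mono_onI) (smt (verit) atLeastAtMost_iff)
  have monoW: "mono_on {c..d} (\<lambda>t. V t - q t)"
    using V by (intro mono_onI) (smt (verit) atLeastAtMost_iff)
  have acW: "absolutely_continuous_fun_on {c..d} (\<lambda>t. V t - q t)"
    unfolding absolutely_continuous_fun_on_def
  proof (intro allI impI)
    fix \<epsilon> :: real assume "\<epsilon> > 0"
    then have e2: "\<epsilon> / 2 > 0" by simp
    obtain \<delta>1 where d1: "\<delta>1 > 0" "\<And>(n::nat) a b. (\<forall>i<n. a i \<le> b i \<and> {a i..b i} \<subseteq> {c..d}) \<Longrightarrow>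
      disjoint_family_on (\<lambda>i. {a i<..<b i}) {..<n} \<Longrightarrow>
      (\<Sum>i<n. b i - a i) < \<delta>1 \<Longrightarrow> (\<Sum>i<n. \<bar>q (b i) - q (a i)\<bar>) < \<epsilon> / 2"
      using ac e2 unfolding absolutely_continuous_fun_on_def by blast
    obtain \<delta>2 where d2: "\<delta>2 > 0" "\<And>(n::nat) a b. (\<forall>i<n. a i \<le> b i \<and> {a i..b i} \<subseteq> {c..d}) \<Longrightarrow>
      disjoint_family_on (\<lambda>i. {a i<..<b i}) {..<n} \<Longrightarrow>
      (\<Sum>i<n. b i - a i) < \<delta>2 \<Longrightarrow> (\<Sum>i<n. \<bar>V (b i) - V (a i)\<bar>) < \<epsilon> / 2"
      using acV e2 unfolding absolutely_continuous_fun_on_def by blast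
    show "\<exists>\<delta>>0. \<forall>(n::nat) a b. (\<forall>i<n. a i \<le> b i \<and> {a i..b i} \<subseteq> {c..d}) \<longrightarrow>
      disjoint_family_on (\<lambda>i. {a i<..<b i}) {..<n} \<longrightarrow> (\<Sum>i<n. b i - a i) < \<delta> \<longrightarrow>
      (\<Sum>i<n. \<bar>V (b i) - q (b i) - (V (a i) - q (a i))\<bar>) < \<epsilon>"
    proof (intro exI[of _ "min \<delta>1 \<delta>2"] conjI allI impI)
      fix n :: nat and a b
      assume fam: "\<forall>i<n. a i \<le> b i \<and> {a i..b i} \<subseteq> {c..d}"
        "disjoint_family_on (\<lambda>i. {a i<..<b i}) {..<n}" and "(\<Sum>i<n. b i - a i) < min \<delta>1 \<delta>2"
      then have len: "(\<Sum>i<n. b i - a i) < \<delta>1" "(\<Sum>i<n. b i - a i) < \<delta>2" by auto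
      have "(\<Sum>i<n. \<bar>V (b i) - q (b i) - (V (a i) - q (a i))\<bar>)
          \<le> (\<Sum>i<n. \<bar>V (b i) - V (a i)\<bar> + \<bar>q (b i) - q (a i)\<bar>)"
        by (intro sum_mono) auto
      also have "\<dots> < \<epsilon>"
        using d1(2)[OF fam len(1)] d2(2)[OF fam len(2)] by (simp add: sum.distrib)
      finally show "(\<Sum>i<n. \<bar>V (b i) - q (b i) - (V (a i) - q (a i))\<bar>) < \<epsilon>" .
    qed (use d1 d2 in auto)
  qed
  obtain g1 where g1: "g1 \<in> borel_measurable borel" "integrable lborel g1"
    "\<And>a b. c \<le> a \<Longrightarrow> a \<le> b \<Longrightarrow> b \<le> d \<Longrightarrow> V b - V a = (LINT x:{a..b}|lborel. g1 x)"
    using mono_absolutely_continuous_fun_on_density[OF acV monoV \<open>c \<le> d\<close>] by metis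
  obtain g2 where g2: "g2 \<in> borel_measurable borel" "integrable lborel g2"
    "\<And>a b. c \<le> a \<Longrightarrow> a \<le> b \<Longrightarrow> b \<le> d \<Longrightarrow> (V b - q b) - (V a - q a) = (LINT x:{a..b}|lborel. g2 x)"
    using mono_absolutely_continuous_fun_on_density[OF acW monoW \<open>c \<le> d\<close>] by metis
  show thesis
  proof (rule that[of "\<lambda>x. g1 x - g2 x"])
    show "(\<lambda>x. g1 x - g2 x) \<in> borel_measurable borel" using g1(1) g2(1) by simp
    show "integrable lborel (\<lambda>x. g1 x - g2 x)" using g1(2) g2(2) by simp
    fix a b assume ab: "c \<le> a" "a \<le> b" "b \<le> d"
    have "set_integrable lborel {a..b} g1" "set_integrable lborel {a..b} g2"
      unfolding set_integrable_def by (intro integrable_mult_indicator g1(2) g2(2); simp)+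
    then show "q b - q a = (LINT x:{a..b}|lborel. g1 x - g2 x)"
      using g1(3)[OF ab] g2(3)[OF ab] by (simp add: set_integral_diff)
  qed
qed

section \<open>Differentiation of indefinite integrals\<close>

lemma AE_negligible_lborel:
  assumes "negligible N" "\<And>x. x \<notin> N \<Longrightarrow> P x"
  shows "AE x in lborel. P x"
proof -
  have "AE x in lebesgue. P x"
    using assms by (intro AE_I'[of N]) (auto simp: negligible_iff_null_sets)
  then show ?thesis by (simp add: AE_completion_iff)
qed

text \<open>The measure \<open>\<nu>\<close> with density \<open>w\<close> vanishes on \<open>{w = 0}\<close>, hence is small on some open neighbourhood
  \<open>U\<close> of it; disjoint Vitali intervals inside \<open>U\<close> on which \<open>\<nu>\<close> dominates length have small total
  length.\<close>

lemma negligible_mean_large_on_zero_set: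
  fixes w :: "real \<Rightarrow> real"
  assumes w: "integrable lborel w" "\<And>x. w x \<ge> 0" and "\<kappa> > 0"
  shows "negligible {t. w t = 0 \<and> (\<forall>\<delta>>0. \<exists>h. 0 < h \<and> h < \<delta> \<and> (LINT s:cball t h|lborel. w s) > \<kappa> * h)}"
    (is "negligible ?S")
  unfolding negligible_outer_le
proof (intro allI impI)
  fix e :: real assume "e > 0"
  have [measurable]: "w \<in> borel_measurable borel" using w(1) by auto
  define \<nu> where "\<nu> = density lborel (\<lambda>x. ennreal (w x))"
  have \<nu>_eq: "emeasure \<nu> B = ennreal (LINT s:B|lborel. w s)" if B: "B \<in> sets borel" for B
  proof -
    have "emeasure \<nu> B = (\<integral>\<^sup>+s. ennreal (indicator B s *\<^sub>R w s) \<partial>lborel)"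
      unfolding \<nu>_def using B by (subst emeasure_density) (auto intro!: nn_integral_cong simp: indicator_def)
    also have "\<dots> = ennreal (LINT s:B|lborel. w s)"
      unfolding set_lebesgue_integral_def using B w
      by (intro nn_integral_eq_integral integrable_mult_indicator) auto
    finally show ?thesis .
  qed
  have "emeasure \<nu> {t. w t = 0} = 0"
    unfolding \<nu>_def by (subst emeasure_density) (auto simp: nn_integral_0_iff_AE indicator_def)
  moreover have "emeasure \<nu> {t. w t = 0} = (INF U\<in>{U. {t. w t = 0} \<subseteq> U \<and> open U}. emeasure \<nu> U)"
    using \<nu>_eq[of UNIV] by (intro outer_regular) (auto simp: \<nu>_def)
  \<comment> \<open>A selected ball of radius \<open>h\<close> has length \<open>2 * h\<close> and
    \<open>\<nu>\<close>-mass above \<open>\<kappa> * h\<close>. Its length is thus at most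
    \<open>2 / \<kappa>\<close> times its mass, which turns \<open>e * \<kappa> / 2\<close> into
    \<open>e\<close>.\<close>
  ultimately have "(INF U\<in>{U. {t. w t = 0} \<subseteq> U \<and> open U}. emeasure \<nu> U) < ennreal (e * \<kappa> / 2)"
    using \<open>e > 0\<close> \<open>\<kappa> > 0\<close> by simp
  then obtain U where U: "{t. w t = 0} \<subseteq> U" "open U" "emeasure \<nu> U < ennreal (e * \<kappa> / 2)"
    unfolding INF_less_iff by auto
  define K where "K = {(t, h). 0 < h \<and> cball t h \<subseteq> U \<and> \<kappa> * h < (LINT s:cball t h|lborel. w s)}"
  obtain C where C: "countable C" "C \<subseteq> K"
     "pairwise (\<lambda>i j. disjnt (cball (fst i) (snd i)) (cball (fst j) (snd j))) C"
     "negligible (?S - (\<Union>i \<in> C. cball (fst i) (snd i)))"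
  proof (rule Vitali_covering_theorem_cballs[of K snd ?S fst])
    show "\<And>i. i \<in> K \<Longrightarrow> 0 < snd i" by (auto simp: K_def)
    fix t d :: real assume t: "t \<in> ?S" and "0 < d"
    have "t \<in> U" using t U(1) by blast
    then obtain \<delta> where \<delta>: "\<delta> > 0" "cball t \<delta> \<subseteq> U"
      using U(2) open_contains_cball[of U] by blast
    have "min d \<delta> > 0" using \<delta> \<open>0 < d\<close> by simp
    then obtain h where h: "0 < h" "h < min d \<delta>" "(LINT s:cball t h|lborel. w s) > \<kappa> * h"
      using t by blast
    moreover have "cball t h \<subseteq> U" using h \<delta>(2) by (auto simp: subset_iff)
    ultimately show "\<exists>i. i \<in> K \<and> t \<in> cball (fst i) (snd i) \<and> snd i < d"
      by (intro exI[of _ "(t, h)"]) (auto simp: K_def)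
  qed blast
  let ?B = "\<lambda>i::real \<times> real. cball (fst i) (snd i)"
  let ?V = "\<Union>i\<in>C. ?B i"
  have dis: "disjoint_family_on ?B C"
    using C(3) unfolding disjoint_family_on_def pairwise_def disjnt_def by blast
  have V_borel: "?V \<in> sets borel" using C(1) by auto
  have "emeasure lborel ?V = (\<integral>\<^sup>+i. emeasure lborel (?B i) \<partial>count_space C)"
    using C(1) dis by (intro emeasure_UN_countable) auto
  also have "\<dots> \<le> (\<integral>\<^sup>+i. ennreal (2 / \<kappa>) * emeasure \<nu> (?B i) \<partial>count_space C)"
  proof (rule nn_integral_mono)
    fix i assume "i \<in> space (count_space C)"
    then obtain t h where i: "i = (t, h)" "0 < h" "\<kappa> * h < (LINT s:cball t h|lborel. w s)"
      using C(2) by (auto simp: K_def)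
    have "emeasure lborel (?B i) = ennreal (2 * h)"
      using i by (simp add: cball_eq_atLeastAtMost)
    also have "\<dots> \<le> ennreal (2 / \<kappa> * (LINT s:cball t h|lborel. w s))"
      using i \<open>\<kappa> > 0\<close> by (intro ennreal_leI) (simp add: field_simps)
    also have "\<dots> = ennreal (2 / \<kappa>) * emeasure \<nu> (?B i)"
      using \<nu>_eq[of "cball t h"] i \<open>\<kappa> > 0\<close> by (simp add: ennreal_mult'[symmetric])
    finally show "emeasure lborel (?B i) \<le> ennreal (2 / \<kappa>) * emeasure \<nu> (?B i)" .
  qed
  also have "\<dots> = ennreal (2 / \<kappa>) * (\<integral>\<^sup>+i. emeasure \<nu> (?B i) \<partial>count_space C)"
    by (intro nn_integral_cmult) auto
  also have "(\<integral>\<^sup>+i. emeasure \<nu> (?B i) \<partial>count_space C) = emeasure \<nu> ?V"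
    using C(1) dis by (intro emeasure_UN_countable[symmetric]) (auto simp: \<nu>_def)
  also have "emeasure \<nu> ?V \<le> emeasure \<nu> U"
  proof (rule emeasure_mono)
    show "?V \<subseteq> U" using C(2) unfolding K_def by fastforce
  qed (use U(2) in \<open>simp add: \<nu>_def\<close>)
  also have "ennreal (2 / \<kappa>) * emeasure \<nu> U \<le> ennreal (2 / \<kappa>) * ennreal (e * \<kappa> / 2)"
    using U(3) by (intro mult_left_mono) auto
  also have "\<dots> = ennreal e"
    using \<open>\<kappa> > 0\<close> \<open>e > 0\<close> by (subst ennreal_mult'[symmetric]) auto
  finally have V: "emeasure lborel ?V \<le> ennreal e" by (simp add: mult_left_mono)
  have V_meas: "?V \<in> lmeasurable"
    using V_borel V by (auto simp: fmeasurable_def intro: le_less_trans)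
  show "\<exists>T. ?S \<subseteq> T \<and> T \<in> lmeasurable \<and> measure lebesgue T \<le> e"
  proof (intro exI[of _ "?V \<union> (?S - ?V)"] conjI)
    show "?S \<subseteq> ?V \<union> (?S - ?V)" by blast
    show "?V \<union> (?S - ?V) \<in> lmeasurable"
      using V_meas negligible_imp_measurable[OF C(4)] by (rule fmeasurable.Un)
    have "measure lebesgue (?V \<union> (?S - ?V)) \<le> measure lebesgue ?V + measure lebesgue (?S - ?V)"
      using V_meas negligible_imp_measurable[OF C(4)] by (intro measure_Un_le) auto
    also have "measure lebesgue (?S - ?V) = 0" using negligible_imp_measure0[OF C(4)] .
    also have "measure lebesgue ?V \<le> e"
      using V V_borel \<open>e > 0\<close> unfolding measure_def by (simp add: enn2real_leI)
    finally show "measure lebesgue (?V \<union> (?S - ?V)) \<le> e" by simp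
  qed
qed

lemma AE_mean_tendsto_zero_on_zero_set:
  fixes w :: "real \<Rightarrow> real"
  assumes w: "integrable lborel w" "\<And>x. w x \<ge> 0"
  shows "AE t in lborel. w t = 0 \<longrightarrow>
    (\<forall>\<epsilon>>0. \<exists>\<delta>>0. \<forall>h. 0 < h \<longrightarrow> h < \<delta> \<longrightarrow> (LINT s:cball t h|lborel. w s) \<le> \<epsilon> * h)"
proof -
  let ?S = "\<lambda>\<kappa>. {t. w t = 0 \<and> (\<forall>\<delta>>0. \<exists>h. 0 < h \<and> h < \<delta> \<and> (LINT s:cball t h|lborel. w s) > \<kappa> * h)}"
  have "negligible (\<Union>n. ?S (1 / real (Suc n)))"
  proof (rule negligible_countable_Union)
    fix S assume "S \<in> range (\<lambda>n. ?S (1 / real (Suc n)))"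
    then obtain n where "S = ?S (1 / real (Suc n))" by blast
    moreover have "negligible (?S (1 / real (Suc n)))"
      by (rule negligible_mean_large_on_zero_set[OF w]) simp
    ultimately show "negligible S" by simp
  qed simp
  then show ?thesis
  proof (rule AE_negligible_lborel)
    fix t assume t: "t \<notin> (\<Union>n. ?S (1 / real (Suc n)))"
    show "w t = 0 \<longrightarrow>
      (\<forall>\<epsilon>>0. \<exists>\<delta>>0. \<forall>h. 0 < h \<longrightarrow> h < \<delta> \<longrightarrow> (LINT s:cball t h|lborel. w s) \<le> \<epsilon> * h)"
    proof (intro impI allI)
      fix \<epsilon> :: real assume "w t = 0" "\<epsilon> > 0"
      obtain n where n: "1 / real (Suc n) < \<epsilon>" using \<open>\<epsilon> > 0\<close> nat_approx_posE by blast
      have "t \<notin> ?S (1 / real (Suc n))" using t by blast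
      then obtain \<delta> where \<delta>: "\<delta> > 0"
        "\<And>h. 0 < h \<Longrightarrow> h < \<delta> \<Longrightarrow> (LINT s:cball t h|lborel. w s) \<le> 1 / real (Suc n) * h"
        using \<open>w t = 0\<close> unfolding mem_Collect_eq by (metis not_less)
      have "(LINT s:cball t h|lborel. w s) \<le> \<epsilon> * h" if h: "0 < h" "h < \<delta>" for h
      proof -
        have "1 / real (Suc n) * h \<le> \<epsilon> * h" using n h by (intro mult_right_mono) auto
        with \<delta>(2)[OF h] show ?thesis by linarith
      qed
      then show "\<exists>\<delta>>0. \<forall>h. 0 < h \<longrightarrow> h < \<delta> \<longrightarrow> (LINT s:cball t h|lborel. w s) \<le> \<epsilon> * h"
        using \<delta>(1) by blast
    qed
  qed
qed

text \<open>The upper half of Lebesgue differentiation. For a rational \<open>r\<close> slightly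
  above \<open>u t\<close> one has \<open>u \<le> r + w\<close>, where the excess
  \<open>w = max (u - r) 0\<close> vanishes at \<open>t\<close> and so has small means near
  \<open>t\<close>. The lower half is the same statement for \<open>- u\<close>.\<close>

lemma AE_mean_le:
  fixes u :: "real \<Rightarrow> real"
  assumes u: "integrable lborel u"
  shows "AE t in lborel. \<forall>\<epsilon>>0. \<exists>\<delta>>0. \<forall>a b. a \<le> t \<longrightarrow> t \<le> b \<longrightarrow> b - a < \<delta> \<longrightarrow>
    (LINT s:{a..b}|lborel. u s) \<le> (u t + \<epsilon>) * (b - a)"
proof -
  have [measurable]: "u \<in> borel_measurable borel" using u by auto
  \<comment> \<open>Truncation to \<open>{- n..n}\<close> keeps the excess integrable even if
    \<open>r < 0\<close>; natural \<open>n\<close> and rational \<open>r\<close> leave only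
    countably many exceptional sets.\<close>
  define w where "w n r s = indicator {- real n..real n} s * max (u s - r) 0" for n :: nat and r s :: real
  have w_int: "integrable lborel (w n r)" for n r
  proof (rule Bochner_Integration.integrable_bound)
    show "integrable lborel (\<lambda>s. \<bar>u s\<bar> + indicator {- real n..real n} s *\<^sub>R \<bar>r\<bar>)"
      using u by (intro Bochner_Integration.integrable_add integrable_abs integrable_scaleR_left) auto
    show "w n r \<in> borel_measurable lborel" unfolding w_def[abs_def] by measurable
    show "AE x in lborel. norm (w n r x) \<le> norm (\<bar>u x\<bar> + indicator {- real n..real n} x *\<^sub>R \<bar>r\<bar>)"
    proof (rule AE_I2)
      fix x
      have "u x \<le> \<bar>u x\<bar>" "- r \<le> \<bar>r\<bar>" by simp_all
      then show "norm (w n r x) \<le> norm (\<bar>u x\<bar> + indicator {- real n..real n} x *\<^sub>R \<bar>r\<bar>)"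
        by (auto simp: w_def indicator_def)
    qed
  qed
  have "AE t in lborel. \<forall>n (r::rat). w n (of_rat r) t = 0 \<longrightarrow>
    (\<forall>\<epsilon>>0. \<exists>\<delta>>0. \<forall>h. 0 < h \<longrightarrow> h < \<delta> \<longrightarrow> (LINT s:cball t h|lborel. w n (of_rat r) s) \<le> \<epsilon> * h)"
    unfolding AE_all_countable
    by (intro allI AE_mean_tendsto_zero_on_zero_set w_int) (simp add: w_def)
  then show ?thesis
  proof eventually_elim
    case (elim t)
    show ?case
    proof (intro allI impI)
      fix \<epsilon> :: real assume "\<epsilon> > 0"
      obtain r where r: "u t < of_rat r" "of_rat r < u t + \<epsilon> / 2"
        using of_rat_dense[of "u t" "u t + \<epsilon> / 2"] \<open>\<epsilon> > 0\<close> by auto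
      obtain n :: nat where n: "\<bar>t\<bar> + 1 < real n" using reals_Archimedean2 by blast
      have "w n (of_rat r) t = 0" using r(1) by (simp add: w_def)
      then obtain \<delta> where \<delta>: "\<delta> > 0"
        "\<And>h. 0 < h \<Longrightarrow> h < \<delta> \<Longrightarrow> (LINT s:cball t h|lborel. w n (of_rat r) s) \<le> \<epsilon> / 2 * h"
        using elim \<open>\<epsilon> > 0\<close> by (meson half_gt_zero)
      \<comment> \<open>Length below 1 and \<open>\<bar>t\<bar> + 1 < real n\<close> keep
        \<open>{a..b}\<close> inside the truncation window; \<open>{a..b}\<close> also lies in the
        ball of radius \<open>b - a\<close> about \<open>t\<close>.\<close>
      have "(LINT s:{a..b}|lborel. u s) \<le> (u t + \<epsilon>) * (b - a)"
        if ab: "a \<le> t" "t \<le> b" "b - a < min \<delta> 1" for a b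
      proof (cases "a = b")
        case True
        have "AE s in lborel. indicator {b..b} s *\<^sub>R u s = 0"
          using AE_lborel_singleton[of b] by eventually_elim simp
        then have "(LINT s:{b..b}|lborel. u s) = 0"
          unfolding set_lebesgue_integral_def by (rule integral_eq_zero_AE)
        with True show ?thesis by simp
      next
        case False
        then have h: "0 < b - a" "b - a < \<delta>" using ab by auto
        have ind: "integrable lborel (\<lambda>s. of_rat r * indicator {a..b} s :: real)"
          by (intro integrable_mult_right integrable_real_indicator) (auto simp: emeasure_lborel_Icc_eq)
        have "(LINT s:{a..b}|lborel. u s) \<le> (\<integral>s. of_rat r * indicator {a..b} s + indicator (cball t (b - a)) s *\<^sub>R w n (of_rat r) s \<partial>lborel)"
          unfolding set_lebesgue_integral_def
        proof (rule integral_mono)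
          show "integrable lborel (\<lambda>s. indicator {a..b} s *\<^sub>R u s)"
            using u by (intro integrable_mult_indicator) auto
          show "integrable lborel (\<lambda>s. of_rat r * indicator {a..b} s + indicator (cball t (b - a)) s *\<^sub>R w n (of_rat r) s)"
            using w_int ind by (intro Bochner_Integration.integrable_add integrable_mult_indicator) auto
          fix s show "indicator {a..b} s *\<^sub>R u s
              \<le> of_rat r * indicator {a..b} s + indicator (cball t (b - a)) s *\<^sub>R w n (of_rat r) s"
            using ab n by (auto simp: w_def indicator_def dist_real_def)
        qed
        also have "\<dots> = of_rat r * (b - a) + (LINT s:cball t (b - a)|lborel. w n (of_rat r) s)"
        proof -
          have "integrable lborel (\<lambda>s. indicator (cball t (b - a)) s *\<^sub>R w n (of_rat r) s)"
            by (intro integrable_mult_indicator w_int) simp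
          from Bochner_Integration.integral_add[OF ind this] h show ?thesis
            by (simp add: set_lebesgue_integral_def)
        qed
        also have "\<dots> \<le> (u t + \<epsilon> / 2) * (b - a) + \<epsilon> / 2 * (b - a)"
          using r h by (intro add_mono \<delta>(2) mult_right_mono) auto
        finally show ?thesis by (simp add: algebra_simps)
      qed
      then show "\<exists>\<delta>>0. \<forall>a b. a \<le> t \<longrightarrow> t \<le> b \<longrightarrow> b - a < \<delta> \<longrightarrow>
          (LINT s:{a..b}|lborel. u s) \<le> (u t + \<epsilon>) * (b - a)"
        using \<delta>(1) by (intro exI[of _ "min \<delta> 1"]) auto
    qed
  qed
qed

text \<open>\<open>AE_mean_le\<close> for \<open>g\<close> and for \<open>- g\<close> bounds the
  mean of \<open>g\<close> over short intervals containing \<open>t\<close> from both sides; with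
  \<open>t\<close> as an endpoint these means are the difference quotients of
  \<open>q\<close>.\<close>

theorem AE_has_derivative_indefinite_integral:
  fixes g q :: "real \<Rightarrow> real"
  assumes g: "integrable lborel g"
    and q: "\<And>a b. c \<le> a \<Longrightarrow> a \<le> b \<Longrightarrow> b \<le> d \<Longrightarrow> q b - q a = (LINT x:{a..b}|lborel. g x)"
  shows "AE t in lborel. t \<in> {c..d} \<longrightarrow> (q has_real_derivative g t) (at t within {c..d})"
proof -
  have "integrable lborel (\<lambda>s. - g s)" using g by simp
  from AE_mean_le[OF g] AE_mean_le[OF this] show ?thesis
  proof eventually_elim
    case (elim t)
    show ?case unfolding has_field_derivative_def has_derivative_within_alt
    proof (intro impI conjI allI)
      show "bounded_linear ((*) (g t))" by (rule bounded_linear_mult_right)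
      fix e :: real assume "e > 0" and t: "t \<in> {c..d}"
      obtain \<delta>1 where d1: "\<delta>1 > 0" "\<And>a b. a \<le> t \<Longrightarrow> t \<le> b \<Longrightarrow> b - a < \<delta>1 \<Longrightarrow>
          (LINT s:{a..b}|lborel. g s) \<le> (g t + e) * (b - a)"
        using elim(1) \<open>e > 0\<close> by meson
      obtain \<delta>2 where d2: "\<delta>2 > 0" "\<And>a b. a \<le> t \<Longrightarrow> t \<le> b \<Longrightarrow> b - a < \<delta>2 \<Longrightarrow>
          (LINT s:{a..b}|lborel. - g s) \<le> (- g t + e) * (b - a)"
        using elim(2) \<open>e > 0\<close> by meson
      have *: "\<bar>q b - q a - g t * (b - a)\<bar> \<le> e * (b - a)"
        if "a \<le> t" "t \<le> b" "c \<le> a" "b \<le> d" "b - a < min \<delta>1 \<delta>2" for a b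
      proof -
        have "(LINT s:{a..b}|lborel. - g s) = - (LINT s:{a..b}|lborel. g s)"
          by (simp add: set_lebesgue_integral_def)
        then show ?thesis
          using d1(2)[of a b] d2(2)[of a b] q[of a b] that by (auto simp: abs_le_iff algebra_simps)
      qed
      show "\<exists>\<delta>>0. \<forall>y\<in>{c..d}. norm (y - t) < \<delta> \<longrightarrow>
          norm (q y - q t - g t * (y - t)) \<le> e * norm (y - t)"
      proof (intro exI[of _ "min \<delta>1 \<delta>2"] conjI ballI impI)
        fix y assume y: "y \<in> {c..d}" "norm (y - t) < min \<delta>1 \<delta>2"
        show "norm (q y - q t - g t * (y - t)) \<le> e * norm (y - t)"
        proof (cases "t \<le> y")
          case True
          then show ?thesis using *[of t y] y t by simp
        next
          case False
          then have "\<bar>q t - q y - g t * (t - y)\<bar> \<le> e * (t - y)" using *[of y t] y t by simp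
          moreover have "q y - q t - g t * (y - t) = - (q t - q y - g t * (t - y))"
            by (simp add: algebra_simps)
          ultimately show ?thesis using False by simp
        qed
      qed (use d1 d2 in auto)
    qed
  qed
qed

text \<open>\<open>E\<close> is a countable union of pieces \<open>P n j\<close> on which \<open>q\<close> has a Lipschitz inverse.\<close>

lemma negligible_of_negligible_image_nonzero_derivative:
  fixes q g :: "real \<Rightarrow> real"
  assumes der: "\<And>t. t \<in> E \<Longrightarrow> (q has_real_derivative g t) (at t within I)"
    and nz: "\<And>t. t \<in> E \<Longrightarrow> g t \<noteq> 0" and "E \<subseteq> I" and neg: "negligible (q ` E)"
  shows "negligible E"
proof -
  \<comment> \<open>\<open>n\<close> records both a radius and an inverse slope at \<open>t\<close>.
    The floor places points of one piece within distance \<open>1 / (n + 1)\<close>, so the local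
    estimate holds between any two of them.\<close>
  define P where "P n j = {t \<in> E. \<lfloor>t * (real n + 1)\<rfloor> = j \<and>
      (\<forall>s\<in>I. \<bar>s - t\<bar> * (real n + 1) < 1 \<longrightarrow> \<bar>s - t\<bar> \<le> (real n + 1) * \<bar>q s - q t\<bar>)}" for n :: nat and j :: int
  have Lip: "\<bar>s - t\<bar> \<le> (real n + 1) * \<bar>q s - q t\<bar>" if "s \<in> P n j" "t \<in> P n j" for n j s t
  proof -
    have "\<lfloor>s * (real n + 1)\<rfloor> = \<lfloor>t * (real n + 1)\<rfloor>" using that by (simp add: P_def)
    then have "\<bar>s * (real n + 1) - t * (real n + 1)\<bar> < 1" by linarith
    then have "\<bar>s - t\<bar> * (real n + 1) < 1" by (simp flip: left_diff_distrib add: abs_mult)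
    then show ?thesis using that \<open>E \<subseteq> I\<close> unfolding P_def by blast
  qed
  have "negligible (P n j)" for n j
  proof -
    have inj: "inj_on q (P n j)" using Lip by (fastforce intro: inj_onI)
    have "negligible (inv_into (P n j) q ` (q ` P n j))"
    proof (rule negligible_locally_Lipschitz_image)
      show "negligible (q ` P n j)" by (rule negligible_subset[OF neg]) (auto simp: P_def)
      fix x assume x: "x \<in> q ` P n j"
      have "norm (inv_into (P n j) q y - inv_into (P n j) q x) \<le> (real n + 1) * norm (y - x)"
        if "y \<in> q ` P n j" for y
        using Lip[of _ n j] inv_into_into[OF x] inv_into_into[OF that] f_inv_into_f[OF x] f_inv_into_f[OF that]
        by (metis real_norm_def)
      then show "\<exists>U B. open U \<and> x \<in> U \<and> (\<forall>y\<in>q ` P n j \<inter> U.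
          norm (inv_into (P n j) q y - inv_into (P n j) q x) \<le> B * norm (y - x))"
        by (intro exI[of _ UNIV] exI[of _ "real n + 1"]) auto
    qed simp
    also have "inv_into (P n j) q ` (q ` P n j) = P n j"
      using inj by (rule inv_into_image_cancel) simp
    finally show ?thesis .
  qed
  then have "negligible (\<Union>n. \<Union>j. P n j)"
    by (intro negligible_countable_Union countable_image) auto
  moreover have "E \<subseteq> (\<Union>n. \<Union>j. P n j)"
  proof
    fix t assume t: "t \<in> E"
    \<comment> \<open>Half the slope is given up to the error term, which leaves
      \<open>\<gamma> * \<bar>s - t\<bar> \<le> \<bar>q s - q t\<bar>\<close>; any \<open>n\<close>
      above \<open>1 / d\<close> and \<open>1 / \<gamma>\<close> then puts \<open>t\<close> into a
      piece.\<close>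
    define \<gamma> where "\<gamma> = \<bar>g t\<bar> / 2"
    have "\<gamma> > 0" using nz[OF t] by (simp add: \<gamma>_def)
    then obtain d where d: "d > 0"
      "\<And>s. s \<in> I \<Longrightarrow> \<bar>s - t\<bar> < d \<Longrightarrow> \<bar>q s - q t - g t * (s - t)\<bar> \<le> \<gamma> * \<bar>s - t\<bar>"
      using der[OF t] unfolding has_field_derivative_def has_derivative_within_alt real_norm_def by meson
    obtain n :: nat where n: "max (1 / d) (1 / \<gamma>) < real n" using reals_Archimedean2 by blast
    have "\<bar>s - t\<bar> \<le> (real n + 1) * \<bar>q s - q t\<bar>" if s: "s \<in> I" "\<bar>s - t\<bar> * (real n + 1) < 1" for s
    proof -
      have "1 < d * (real n + 1)" "1 < \<gamma> * (real n + 1)" using n \<open>d > 0\<close> \<open>\<gamma> > 0\<close> by (auto simp: field_simps)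
      then have "\<bar>s - t\<bar> * (real n + 1) < d * (real n + 1)" using s(2) by linarith
      then have "\<bar>s - t\<bar> < d" by simp
      from d(2)[OF s(1) this] have "\<bar>g t * (s - t)\<bar> - \<gamma> * \<bar>s - t\<bar> \<le> \<bar>q s - q t\<bar>" by linarith
      then have "\<gamma> * \<bar>s - t\<bar> \<le> \<bar>q s - q t\<bar>" by (simp add: abs_mult \<gamma>_def)
      then have *: "(real n + 1) * (\<gamma> * \<bar>s - t\<bar>) \<le> (real n + 1) * \<bar>q s - q t\<bar>"
        by (intro mult_left_mono) auto
      have "1 * \<bar>s - t\<bar> \<le> (\<gamma> * (real n + 1)) * \<bar>s - t\<bar>"
        using \<open>1 < \<gamma> * (real n + 1)\<close> by (intro mult_right_mono) auto
      also have "\<dots> = (real n + 1) * (\<gamma> * \<bar>s - t\<bar>)" by (simp only: mult_ac)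
      also note *
      finally show ?thesis by simp
    qed
    then have "t \<in> P n \<lfloor>t * (real n + 1)\<rfloor>" using t by (simp add: P_def)
    then show "t \<in> (\<Union>n. \<Union>j. P n j)" by blast
  qed
  ultimately show ?thesis by (rule negligible_subset)
qed

section \<open>Integrals along loops\<close>

lemma set_integral_Icc_combine:
  fixes h :: "real \<Rightarrow> real"
  assumes "integrable lborel h" "a \<le> b" "b \<le> c"
  shows "(LINT s:{a..c}|lborel. h s) = (LINT s:{a..b}|lborel. h s) + (LINT s:{b..c}|lborel. h s)"
proof -
  have int: "integrable lborel (\<lambda>s. indicator {x..y} s *\<^sub>R h s)" for x y
    using assms(1) by (intro integrable_mult_indicator) auto
  have "(LINT s:{a..c}|lborel. h s) = (\<integral>s. indicator {a..b} s *\<^sub>R h s + indicator {b..c} s *\<^sub>R h s \<partial>lborel)"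
    unfolding set_lebesgue_integral_def
  proof (rule integral_cong_AE)
    show "AE s in lborel. indicator {a..c} s *\<^sub>R h s = indicator {a..b} s *\<^sub>R h s + indicator {b..c} s *\<^sub>R h s"
      using AE_lborel_singleton[of b] by eventually_elim (use assms(2,3) in \<open>auto simp: indicator_def\<close>)
  qed (use int assms(1) in auto)
  also have "\<dots> = (LINT s:{a..b}|lborel. h s) + (LINT s:{b..c}|lborel. h s)"
    unfolding set_lebesgue_integral_def by (rule Bochner_Integration.integral_add[OF int int])
  finally show ?thesis .
qed

text \<open>The defect \<open>D\<close> and its bound \<open>G\<close> are both additive over
  adjacent intervals, so by bisection it is enough to compare them near a point \<open>t\<close>,
  where \<open>k (q s)\<close> is frozen at \<open>k (q t)\<close>. This avoids differentiating the
  composition of \<open>K\<close> with \<open>q\<close>.\<close>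

lemma integral_chain_rule:
  fixes g q k K :: "real \<Rightarrow> real"
  assumes g: "integrable lborel g" and "c \<le> d"
    and q: "\<And>a b. c \<le> a \<Longrightarrow> a \<le> b \<Longrightarrow> b \<le> d \<Longrightarrow> q b - q a = (LINT s:{a..b}|lborel. g s)"
    and q_cont: "continuous_on UNIV q" and k_cont: "continuous_on UNIV k"
    and K: "\<And>u. (K has_real_derivative k u) (at u)"
  shows "K (q d) - K (q c) = (LINT s:{c..d}|lborel. k (q s) * g s)"
proof -
  have [measurable]: "g \<in> borel_measurable borel" "q \<in> borel_measurable borel" "k \<in> borel_measurable borel"
    using g q_cont k_cont by (auto intro: borel_measurable_continuous_onI)
  \<comment> \<open>Cut off outside \<open>{c..d}\<close>, where \<open>k (q s)\<close> may be
    unbounded, so that \<open>h\<close> is integrable on the line.\<close>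
  define h where "h s = indicator {c..d} s * (k (q s) * g s)" for s
  have "compact ((\<lambda>s. k (q s)) ` {c..d})"
    by (intro compact_continuous_image continuous_on_compose2[OF k_cont] continuous_on_subset[OF q_cont]) auto
  then have "bounded ((\<lambda>s. k (q s)) ` {c..d})" by (rule compact_imp_bounded)
  then obtain B where "\<forall>s\<in>{c..d}. \<bar>k (q s)\<bar> \<le> B" unfolding bounded_iff by auto
  then have B: "\<bar>k (q s)\<bar> \<le> B" if "s \<in> {c..d}" for s using that by blast
  have h_int: "integrable lborel h"
  proof (rule Bochner_Integration.integrable_bound)
    show "integrable lborel (\<lambda>s. B * g s)" using g by simp
    show "h \<in> borel_measurable lborel" unfolding h_def[abs_def] by measurable
    have "norm (h s) \<le> norm (B * g s)" for s
      using mult_right_mono[OF order.trans[OF B[of s] abs_ge_self] abs_ge_zero[of "g s"]]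
      by (auto simp: h_def indicator_def abs_mult)
    then show "AE s in lborel. norm (h s) \<le> norm (B * g s)" by simp
  qed
  have abs_int: "integrable lborel (\<lambda>s. \<bar>g s\<bar>)" using g by simp
  define D where "D a b = K (q b) - K (q a) - (LINT s:{a..b}|lborel. h s)" for a b
  define G where "G a b = (LINT s:{a..b}|lborel. \<bar>g s\<bar>)" for a b
  have "\<bar>D c d\<bar> \<le> \<epsilon> * G c d" if "\<epsilon> > 0" for \<epsilon>
  proof -
    define P where "P a b \<longleftrightarrow> (c \<le> a \<longrightarrow> b \<le> d \<longrightarrow> \<bar>D a b\<bar> \<le> \<epsilon> * G a b)" for a b
    from \<open>c \<le> d\<close> have "P c d"
    proof (induction rule: Bolzano)
      case (trans x y z)
      show ?case unfolding P_def
      proof (intro impI)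
        assume "c \<le> x" "z \<le> d"
        with trans have "\<bar>D x y\<bar> \<le> \<epsilon> * G x y" "\<bar>D y z\<bar> \<le> \<epsilon> * G y z"
          unfolding P_def by auto
        moreover have "D x z = D x y + D y z"
          unfolding D_def set_integral_Icc_combine[OF h_int trans(3,4)] by simp
        moreover have "G x z = G x y + G y z"
          unfolding G_def by (rule set_integral_Icc_combine[OF abs_int trans(3,4)])
        ultimately show "\<bar>D x z\<bar> \<le> \<epsilon> * G x z" by (simp add: distrib_left)
      qed
    next
      case (local t)
      obtain \<eta> where \<eta>: "\<eta> > 0" "\<And>u. \<bar>u - q t\<bar> < \<eta> \<Longrightarrow> \<bar>k u - k (q t)\<bar> < \<epsilon> / 2"
        using k_cont half_gt_zero[OF \<open>\<epsilon> > 0\<close>] unfolding continuous_on_iff dist_real_def by blast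
      obtain \<delta> where \<delta>: "\<delta> > 0" "\<And>s. \<bar>s - t\<bar> < \<delta> \<Longrightarrow> \<bar>q s - q t\<bar> < \<eta>"
        using q_cont \<eta>(1) unfolding continuous_on_iff dist_real_def by blast
      have "\<bar>D a b\<bar> \<le> \<epsilon> * G a b"
        if ab: "a \<le> t" "t \<le> b" "b - a < \<delta>" and cd: "c \<le> a" "b \<le> d" for a b
      proof -
        have int: "integrable lborel (\<lambda>s. indicator {a..b} s *\<^sub>R f s)" if "integrable lborel f" for f :: "real \<Rightarrow> real"
          using that by (intro integrable_mult_indicator) auto
        have near: "\<bar>q s - q t\<bar> < \<eta>" if "s \<in> {a..b}" for s using \<delta>(2)[of s] ab that by auto
        have G0: "\<bar>q b - q a\<bar> \<le> G a b"
        proof -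
          have "\<bar>LINT s:{a..b}|lborel. g s\<bar> \<le> (LINT s:{a..b}|lborel. norm (g s))"
            using set_integral_norm_bound[of lborel "{a..b}" g] int[OF g] unfolding set_integrable_def by simp
          then show ?thesis using q[of a b] ab cd by (simp add: G_def)
        qed
        \<comment> \<open>Mean value inequality for \<open>K\<close> minus its frozen linear part;
          this error and that of the integral each take \<open>\<epsilon> / 2\<close>.\<close>
        have "norm ((K (q b) - k (q t) * q b) - (K (q a) - k (q t) * q a)) \<le> \<epsilon> / 2 * norm (q b - q a)"
        proof (rule field_differentiable_bound[where S = "ball (q t) \<eta>" and f' = "\<lambda>u. k u - k (q t)"])
          fix u assume "u \<in> ball (q t) \<eta>"
          show "((\<lambda>u. K u - k (q t) * u) has_field_derivative k u - k (q t)) (at u within ball (q t) \<eta>)"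
            by (auto intro!: derivative_eq_intros has_field_derivative_at_within[OF K])
          show "norm (k u - k (q t)) \<le> \<epsilon> / 2"
            using \<eta>(2)[of u] \<open>u \<in> ball (q t) \<eta>\<close> by (auto simp: dist_real_def abs_minus_commute)
        qed (use near[of a] near[of b] ab in \<open>auto simp: dist_real_def abs_minus_commute\<close>)
        also have "\<dots> \<le> \<epsilon> / 2 * G a b" using G0 \<open>\<epsilon> > 0\<close> by (intro mult_left_mono) auto
        finally have 1: "\<bar>K (q b) - K (q a) - k (q t) * (q b - q a)\<bar> \<le> \<epsilon> / 2 * G a b"
          by (simp add: algebra_simps)
        have "\<bar>(LINT s:{a..b}|lborel. h s - k (q t) * g s)\<bar> \<le> (LINT s:{a..b}|lborel. \<bar>h s - k (q t) * g s\<bar>)"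
          using set_integral_norm_bound[of lborel "{a..b}" "\<lambda>s. h s - k (q t) * g s"]
            int[of "\<lambda>s. h s - k (q t) * g s"] h_int g unfolding set_integrable_def by simp
        also have "\<dots> \<le> (LINT s:{a..b}|lborel. \<epsilon> / 2 * \<bar>g s\<bar>)"
        proof (rule set_integral_mono)
          show "set_integrable lborel {a..b} (\<lambda>s. \<bar>h s - k (q t) * g s\<bar>)"
            "set_integrable lborel {a..b} (\<lambda>s. \<epsilon> / 2 * \<bar>g s\<bar>)"
            unfolding set_integrable_def using h_int g by (intro int integrable_abs; simp)+
          fix s assume s: "s \<in> {a..b}"
          have "h s - k (q t) * g s = (k (q s) - k (q t)) * g s"
            using s cd by (simp add: h_def algebra_simps)
          then show "\<bar>h s - k (q t) * g s\<bar> \<le> \<epsilon> / 2 * \<bar>g s\<bar>"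
            using mult_right_mono[OF less_imp_le[OF \<eta>(2)[OF near[OF s]]], of "\<bar>g s\<bar>"]
            by (simp add: abs_mult)
        qed
        also have "\<dots> = \<epsilon> / 2 * G a b" unfolding G_def by simp
        finally have "\<bar>(LINT s:{a..b}|lborel. h s - k (q t) * g s)\<bar> \<le> \<epsilon> / 2 * G a b" .
        moreover have "(LINT s:{a..b}|lborel. h s - k (q t) * g s)
            = (LINT s:{a..b}|lborel. h s) - k (q t) * (q b - q a)"
          using q[of a b] ab cd int[OF h_int] int[of "\<lambda>s. k (q t) * g s"] g
          by (subst set_integral_diff) (auto simp: set_integrable_def)
        ultimately show ?thesis using 1 unfolding D_def by linarith
      qed
      then show ?case using \<delta>(1) unfolding P_def by (intro exI[of _ \<delta>]) simp
    qed
    then show ?thesis by (simp add: P_def)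
  qed
  note * = this
  have "\<bar>D c d\<bar> \<le> 0"
  proof (rule field_le_epsilon)
    fix e :: real assume "e > 0"
    have "G c d \<ge> 0" unfolding G_def set_lebesgue_integral_def by (intro integral_nonneg_AE) auto
    \<comment> \<open>Dividing by \<open>G c d + 1\<close> covers \<open>G c d = 0\<close>.\<close>
    then have "e / (G c d + 1) * G c d \<le> e" using \<open>e > 0\<close> by (simp add: field_simps)
    then show "\<bar>D c d\<bar> \<le> 0 + e" using *[of "e / (G c d + 1)"] \<open>e > 0\<close> \<open>G c d \<ge> 0\<close> by simp
  qed
  then have "K (q d) - K (q c) = (LINT s:{c..d}|lborel. h s)" by (simp add: D_def)
  also have "\<dots> = (LINT s:{c..d}|lborel. k (q s) * g s)"
    by (rule set_lebesgue_integral_cong) (auto simp: h_def)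
  finally show ?thesis .
qed

text \<open>Differences of shifted copies are antiderivatives of ramps; only \<open>u = 0\<close>,
  where two formulas meet, requires an estimate.\<close>

lemma has_real_derivative_pos_part_squared:
  "((\<lambda>u::real. (max 0 u)\<^sup>2 / 2) has_real_derivative max 0 u) (at u)"
proof -
  consider "u < 0" | "u = 0" | "u > 0" by linarith
  then show ?thesis
  proof cases
    case 1
    have "((\<lambda>u. 0) has_real_derivative 0) (at u)" by simp
    then have "((\<lambda>u::real. (max 0 u)\<^sup>2 / 2) has_real_derivative 0) (at u)"
      by (rule has_field_derivative_transform_within_open[where S = "{..<0}"]) (use 1 in auto)
    then show ?thesis using 1 by simp
  next
    case 2
    have "((\<lambda>u::real. (max 0 u)\<^sup>2 / 2) has_real_derivative 0) (at 0)"
      unfolding has_field_derivative_def has_derivative_within_alt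
    proof (intro conjI allI impI)
      show "bounded_linear ((*) (0::real))" by (rule bounded_linear_mult_right)
      fix e :: real assume "e > 0"
      have "(max 0 y)\<^sup>2 / 2 \<le> e * \<bar>y\<bar>" if "\<bar>y\<bar> < e" for y :: real
      proof -
        have "(max 0 y)\<^sup>2 / 2 \<le> (max 0 y)\<^sup>2" by simp
        also have "\<dots> \<le> \<bar>y\<bar> * \<bar>y\<bar>" by (auto simp: max_def power2_eq_square)
        also have "\<dots> \<le> e * \<bar>y\<bar>" using that by (intro mult_right_mono) auto
        finally show ?thesis .
      qed
      then show "\<exists>d>0. \<forall>y\<in>(UNIV::real set). norm (y - 0) < d \<longrightarrow>
          norm ((max 0 y)\<^sup>2 / 2 - (max 0 0)\<^sup>2 / 2 - 0 * (y - 0)) \<le> e * norm (y - 0)"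
        using \<open>e > 0\<close> by (intro exI[of _ e]) auto
    qed
    then show ?thesis using 2 by simp
  next
    case 3
    have "((\<lambda>u. u\<^sup>2 / 2) has_real_derivative u) (at u)" by (auto intro!: derivative_eq_intros)
    then have "((\<lambda>u::real. (max 0 u)\<^sup>2 / 2) has_real_derivative u) (at u)"
      by (rule has_field_derivative_transform_within_open[where S = "{0<..}"]) (use 3 in auto)
    then show ?thesis using 3 by simp
  qed
qed

context
  fixes g q :: "real \<Rightarrow> real" and c d :: real
  assumes g: "integrable lborel g" and cd: "c \<le> d"
    and q: "\<And>a b. c \<le> a \<Longrightarrow> a \<le> b \<Longrightarrow> b \<le> d \<Longrightarrow> q b - q a = (LINT s:{a..b}|lborel. g s)"
    and q_cont: "continuous_on UNIV q" and closed: "q c = q d"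
begin

text \<open>The indicator is a bounded pointwise limit of continuous functions. The antiderivative
  of each returns to its starting value along the loop, and dominated convergence with bound
  \<open>\<bar>g s\<bar>\<close> passes to the limit.\<close>

lemma loop_integral_superlevel_set_eq_0:
  "(LINT s:{c..d}|lborel. indicator {r<..} (q s) * g s) = 0"
proof -
  have [measurable]: "g \<in> borel_measurable borel" "q \<in> borel_measurable borel"
    using g q_cont by (auto intro: borel_measurable_continuous_onI)
  \<comment> \<open>A ramp from 0 at \<open>r\<close> to 1 at \<open>r + 1 / real (Suc n)\<close>;
    it is 0 at \<open>r\<close> itself, matching the open half-line.\<close>
  define k where "k n u = real (Suc n) * (max 0 (u - r) - max 0 (u - r - 1 / real (Suc n)))" for n u
  define K where "K n u = real (Suc n) * ((max 0 (u - r))\<^sup>2 / 2 - (max 0 (u - r - 1 / real (Suc n)))\<^sup>2 / 2)" for n u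
  have k_cont: "continuous_on UNIV (k n)" for n unfolding k_def by (intro continuous_intros)
  have [measurable]: "k n \<in> borel_measurable borel" for n
    using k_cont by (rule borel_measurable_continuous_onI)
  have "((\<lambda>u. (max 0 (u - a))\<^sup>2 / 2) has_real_derivative max 0 (u - a)) (at u)" for a u :: real
  proof -
    have "((\<lambda>u. u - a) has_real_derivative 1) (at u)" by (auto intro!: derivative_eq_intros)
    from DERIV_chain2[OF has_real_derivative_pos_part_squared this] show ?thesis by simp
  qed
  then have "(K n has_real_derivative k n u) (at u)" for n u
    unfolding K_def k_def diff_diff_eq by (intro DERIV_cmult DERIV_diff)
  from integral_chain_rule[OF g cd q q_cont k_cont this]
  have zero: "(LINT s:{c..d}|lborel. k n (q s) * g s) = 0" for n using closed by simp
  have k_bd: "\<bar>k n u\<bar> \<le> 1" for n u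
  proof -
    have "0 \<le> max 0 (u - r) - max 0 (u - r - x) \<and> max 0 (u - r) - max 0 (u - r - x) \<le> x"
      if "x > 0" for x using that by (auto simp: max_def)
    from this[of "1 / real (Suc n)"] have "\<bar>max 0 (u - r) - max 0 (u - r - 1 / real (Suc n))\<bar> \<le> 1 / real (Suc n)"
      by (simp add: abs_le_iff)
    then have "real (Suc n) * \<bar>max 0 (u - r) - max 0 (u - r - 1 / real (Suc n))\<bar> \<le> real (Suc n) * (1 / real (Suc n))"
      by (intro mult_left_mono) auto
    then show ?thesis by (simp add: k_def abs_mult)
  qed
  have k_lim: "(\<lambda>n. k n u) \<longlonglongrightarrow> indicator {r<..} u" for u
  proof (cases "u \<le> r")
    case True
    then have "max 0 (u - r - x) = 0" if "x \<ge> 0" for x using that by simp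
    from this[of "1 / real (Suc _)"] True have "k n u = 0" for n by (simp add: k_def)
    then show ?thesis using True by simp
  next
    case False
    then obtain N where N: "1 / real (Suc N) < u - r" using nat_approx_posE[of "u - r"] by auto
    have "k n u = 1" if "n \<ge> N" for n
    proof -
      have "1 / real (Suc n) \<le> 1 / real (Suc N)" using that by (simp add: field_simps)
      with N have "1 / real (Suc n) < u - r" by simp
      then have "max 0 (u - r) - max 0 (u - r - 1 / real (Suc n)) = 1 / real (Suc n)"
        using False by (simp only: max_def) simp
      then show ?thesis unfolding k_def by simp
    qed
    then have "\<forall>\<^sub>F n in sequentially. k n u = indicator {r<..} u"
      using False by (auto simp: eventually_sequentially)
    then show ?thesis by (rule tendsto_eventually)
  qed
  have "(\<lambda>n. LINT s:{c..d}|lborel. k n (q s) * g s) \<longlonglongrightarrow> (LINT s:{c..d}|lborel. indicator {r<..} (q s) * g s)"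
    unfolding set_lebesgue_integral_def
  proof (rule integral_dominated_convergence)
    show "integrable lborel (\<lambda>s. \<bar>g s\<bar>)" using g by simp
    show "AE s in lborel. (\<lambda>n. indicator {c..d} s *\<^sub>R (k n (q s) * g s))
        \<longlonglongrightarrow> indicator {c..d} s *\<^sub>R (indicator {r<..} (q s) * g s)"
      by (intro AE_I2 tendsto_intros k_lim)
    have "norm (indicator {c..d} s *\<^sub>R (k n (q s) * g s)) \<le> \<bar>g s\<bar>" for n s
      using mult_right_mono[OF k_bd[of n "q s"] abs_ge_zero[of "g s"]] by (auto simp: indicator_def abs_mult)
    then show "AE s in lborel. norm (indicator {c..d} s *\<^sub>R (k n (q s) * g s)) \<le> \<bar>g s\<bar>" for n by simp
  qed measurable
  then show ?thesis by (simp add: zero LIMSEQ_const_iff)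
qed

text \<open>The images under \<open>q\<close> of the measures with densities \<open>g\<^sup>+\<close> and \<open>g\<^sup>-\<close> agree on half-lines, hence
  on all Borel sets; this admits unbounded \<open>F\<close>, for which no chain rule is available.\<close>

theorem loop_integral_eq_0:
  fixes F :: "real \<Rightarrow> real"
  assumes F[measurable]: "F \<in> borel_measurable borel" and F_int: "set_integrable lborel {c..d} (\<lambda>s. F (q s) * g s)"
  shows "(LINT s:{c..d}|lborel. F (q s) * g s) = 0"
proof -
  have [measurable]: "g \<in> borel_measurable borel" "q \<in> borel_measurable borel"
    using g q_cont by (auto intro: borel_measurable_continuous_onI)
  define p where "p s = indicator {c..d} s * max 0 (g s)" for s
  define m where "m s = indicator {c..d} s * max 0 (- g s)" for s
  have pm[measurable]: "p \<in> borel_measurable borel" "m \<in> borel_measurable borel"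
    unfolding p_def[abs_def] m_def[abs_def] by measurable
  have pos: "p s \<ge> 0" "m s \<ge> 0" for s by (auto simp: p_def m_def)
  have diff: "indicator {c..d} s *\<^sub>R (x * g s) = x * p s - x * m s" for s x
    by (auto simp: p_def m_def indicator_def max_def)
  have pm_int: "integrable lborel (\<lambda>s. x s * p s)" "integrable lborel (\<lambda>s. x s * m s)"
    if "x \<in> borel_measurable borel" "integrable lborel (\<lambda>s. indicator {c..d} s *\<^sub>R (x s * g s))" for x
    by (rule Bochner_Integration.integrable_bound[OF that(2)];
        use that(1) in \<open>auto simp: p_def m_def indicator_def abs_mult intro!: mult_left_mono\<close>)+
  define \<mu>p where "\<mu>p = distr (density lborel (\<lambda>s. ennreal (p s))) borel q"
  define \<mu>m where "\<mu>m = distr (density lborel (\<lambda>s. ennreal (m s))) borel q"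
  have emeas: "emeasure (distr (density lborel (\<lambda>s. ennreal (x s))) borel q) {r<..}
      = ennreal (\<integral>s. indicator {r<..} (q s) * x s \<partial>lborel)"
    if [measurable]: "x \<in> borel_measurable borel" and "\<And>s. x s \<ge> 0"
      and "integrable lborel (\<lambda>s. indicator {r<..} (q s) * x s)" for x r
  proof -
    have "emeasure (distr (density lborel (\<lambda>s. ennreal (x s))) borel q) {r<..}
        = (\<integral>\<^sup>+s. ennreal (x s) * indicator (q -` {r<..}) s \<partial>lborel)"
      using measurable_sets[of q borel borel "{r<..}"] by (simp add: emeasure_distr emeasure_density)
    also have "\<dots> = (\<integral>\<^sup>+s. ennreal (indicator {r<..} (q s) * x s) \<partial>lborel)"
      by (intro nn_integral_cong) (auto simp: indicator_def)
    also have "\<dots> = ennreal (\<integral>s. indicator {r<..} (q s) * x s \<partial>lborel)"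
      using that by (intro nn_integral_eq_integral) auto
    finally show ?thesis .
  qed
  have ind_int: "integrable lborel (\<lambda>s. indicator {c..d} s *\<^sub>R (indicator {r<..} (q s) * g s))" for r
    by (rule Bochner_Integration.integrable_bound[OF g]) (auto simp: indicator_def)
  have ind: "integrable lborel (\<lambda>s. indicator {r<..} (q s) * p s)"
      "integrable lborel (\<lambda>s. indicator {r<..} (q s) * m s)" for r
    by (rule pm_int[OF _ ind_int]; measurable)+
  have "\<mu>p = \<mu>m"
  proof (rule measure_eqI_lessThan)
    fix r :: real
    have "(\<integral>s. indicator {r<..} (q s) * p s \<partial>lborel) - (\<integral>s. indicator {r<..} (q s) * m s \<partial>lborel) = 0"
      using loop_integral_superlevel_set_eq_0[of r] ind[of r]
      unfolding set_lebesgue_integral_def diff by (simp add: Bochner_Integration.integral_diff)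
    then show "emeasure \<mu>p {r<..} = emeasure \<mu>m {r<..}"
      unfolding \<mu>p_def \<mu>m_def using ind pm pos by (simp add: emeas)
    show "emeasure \<mu>p {r<..} < \<infinity>"
      unfolding \<mu>p_def using ind pm pos by (simp add: emeas)
  qed (simp_all add: \<mu>p_def \<mu>m_def)
  then have "(\<integral>u. F u \<partial>\<mu>p) = (\<integral>u. F u \<partial>\<mu>m)" by simp
  then have "(\<integral>s. p s * F (q s) \<partial>lborel) = (\<integral>s. m s * F (q s) \<partial>lborel)"
    unfolding \<mu>p_def \<mu>m_def using pos by (simp add: integral_distr integral_density)
  moreover have "integrable lborel (\<lambda>s. F (q s) * p s)" "integrable lborel (\<lambda>s. F (q s) * m s)"
    using F_int unfolding set_integrable_def by (intro pm_int; measurable; simp)+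
  ultimately show ?thesis
    unfolding set_lebesgue_integral_def diff by (simp add: Bochner_Integration.integral_diff mult.commute)
qed

end

section \<open>Deterministic integrands against Brownian motion\<close>

text \<open>Completeness absorbs the null set on which preimages differ. This serves
  \<open>X T\<close>, which is specified only almost surely, and Lebesgue integrands that agree
  almost everywhere with Borel ones.\<close>

lemma (in complete_measure) borel_measurable_AE_cong:
  fixes f g :: "'a \<Rightarrow> 'b::topological_space"
  assumes f: "f \<in> borel_measurable M" and ae: "AE x in M. f x = g x"
  shows "g \<in> borel_measurable M"
proof (rule measurableI)
  fix B :: "'b set" assume B: "B \<in> sets borel"
  show "g -` B \<inter> space M \<in> sets M"
  proof (rule in_sets_AE)
    show "f -` B \<inter> space M \<in> sets M" using measurable_sets[OF f B] .
    show "AE x in M. x \<in> f -` B \<inter> space M \<longleftrightarrow> x \<in> g -` B \<inter> space M"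
      using ae by eventually_elim auto
  qed auto
qed simp

context brownian_motion
begin

section \<open>First moments and joint measurability of Brownian motion\<close>

lemma W_measurable: "0 \<le> t \<Longrightarrow> W t \<in> borel_measurable M"
  using W_adapted F_subalgebra by (metis measurable_from_subalg)

lemma W_distributed: "0 < t \<Longrightarrow> distributed M lborel (\<lambda>\<omega>. W t \<omega> - W 0 \<omega>) (normal_density 0 (sqrt t))"
  using W_increment_normal[of 0 t] by simp

text \<open>Gaussian moments of the increment from time 0, together with \<open>W 0 = 0\<close>
  almost surely. The bound comes from \<open>\<bar>x\<bar> \<le> 1 + x\<^sup>2\<close>; being
  locally bounded in \<open>t\<close>, it supplies the domination for Fubini.\<close>

lemma
  assumes "0 \<le> t"
  shows integrable_W: "integrable M (W t)" and expectation_W: "(\<integral>\<omega>. W t \<omega> \<partial>M) = 0"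
    and expectation_abs_W_le: "(\<integral>\<omega>. \<bar>W t \<omega>\<bar> \<partial>M) \<le> 1 + t"
proof -
  let ?X = "\<lambda>\<omega>. W t \<omega> - W 0 \<omega>"
  have [measurable]: "W t \<in> borel_measurable M" "W 0 \<in> borel_measurable M"
    using W_measurable assms by auto
  have eq: "AE \<omega> in M. W t \<omega> = ?X \<omega>" using W_zero by eventually_elim simp
  have X: "integrable M ?X" "(\<integral>\<omega>. ?X \<omega> \<partial>M) = 0" "(\<integral>\<omega>. \<bar>?X \<omega>\<bar> \<partial>M) \<le> 1 + t"
  proof -
    \<comment> \<open>At \<open>t = 0\<close> the increment is degenerate and has no normal
      density.\<close>
    consider "t = 0" | "t > 0" using assms by linarith
    then have "integrable M ?X \<and> (\<integral>\<omega>. ?X \<omega> \<partial>M) = 0 \<and> (\<integral>\<omega>. \<bar>?X \<omega>\<bar> \<partial>M) \<le> 1 + t"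
    proof cases
      case 2
      note D = W_distributed[OF 2]
      have moment: "integrable lborel (\<lambda>x. normal_density 0 (sqrt t) x * x ^ k)" for k
        using integrable_normal_moment[of "sqrt t" 0 k] 2 by simp
      have sq: "integrable M (\<lambda>\<omega>. (?X \<omega>)\<^sup>2)"
        by (rule iffD1[OF distributed_integrable[OF D] moment[of 2]]) auto
      have int: "integrable M ?X"
        using iffD1[OF distributed_integrable[OF D] moment[of 1]] by simp
      have ex: "(\<integral>\<omega>. ?X \<omega> \<partial>M) = 0"
        using normal_distributed_expectation[OF _ D] 2 by simp
      have "(\<integral>\<omega>. (?X \<omega>)\<^sup>2 \<partial>M) = t"
        using normal_distributed_variance[OF _ D] 2 ex by simp
      moreover have "(\<integral>\<omega>. \<bar>?X \<omega>\<bar> \<partial>M) \<le> (\<integral>\<omega>. 1 + (?X \<omega>)\<^sup>2 \<partial>M)"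
      proof (rule integral_mono)
        have "2 * \<bar>x\<bar> \<le> 1 + x\<^sup>2" for x :: real using zero_le_power2[of "\<bar>x\<bar> - 1"]
          by (simp add: power2_eq_square algebra_simps)
        then show "\<bar>?X \<omega>\<bar> \<le> 1 + (?X \<omega>)\<^sup>2" for \<omega> by (smt (verit))
      qed (use int sq in auto)
      ultimately show ?thesis using int ex sq by (simp add: prob_space)
    qed simp
    then show "integrable M ?X" "(\<integral>\<omega>. ?X \<omega> \<partial>M) = 0" "(\<integral>\<omega>. \<bar>?X \<omega>\<bar> \<partial>M) \<le> 1 + t" by auto
  qed
  have "integrable M (W t) \<longleftrightarrow> integrable M ?X" using eq by (intro integrable_cong_AE) auto
  then show "integrable M (W t)" using X by simp
  have "(\<integral>\<omega>. W t \<omega> \<partial>M) = (\<integral>\<omega>. ?X \<omega> \<partial>M)" using eq by (intro integral_cong_AE) auto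
  then show "(\<integral>\<omega>. W t \<omega> \<partial>M) = 0" using X by simp
  have "(\<integral>\<omega>. \<bar>W t \<omega>\<bar> \<partial>M) = (\<integral>\<omega>. \<bar>?X \<omega>\<bar> \<partial>M)" using eq by (intro integral_cong_AE) auto
  then show "(\<integral>\<omega>. \<bar>W t \<omega>\<bar> \<partial>M) \<le> 1 + t" using X by simp
qed

text \<open>\<open>V\<close> is the limit of \<open>W\<close> sampled on grids of mesh
  \<open>1 / real (Suc n)\<close>. Each sampled process is jointly measurable, as a measurable
  selection among countably many random variables, and the limit recovers \<open>W\<close> along
  every continuous path.\<close>

lemma jointly_measurable_version:
  obtains V :: "real \<Rightarrow> 'a \<Rightarrow> real" where "case_prod V \<in> borel_measurable (borel \<Otimes>\<^sub>M M)"
    "AE \<omega> in M. \<forall>t\<ge>0. V t \<omega> = W t \<omega>"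
proof -
  \<comment> \<open>\<open>nat\<close> sends negative times to 0, so every sample time is
    nonnegative, as \<open>W_measurable\<close> demands.\<close>
  define V' where "V' n = (\<lambda>(s, \<omega>). W (real (nat \<lfloor>s * real (Suc n)\<rfloor>) / real (Suc n)) \<omega>)" for n
  define V where "V s \<omega> = lim (\<lambda>n. V' n (s, \<omega>))" for s \<omega>
  have V'_meas: "V' n \<in> borel_measurable (borel \<Otimes>\<^sub>M M)" for n
  proof -
    have "(\<lambda>p. (\<lambda>p. W (real (nat \<lfloor>fst p * real (Suc n)\<rfloor>) / real (Suc n)) (snd p)) p) \<in> borel_measurable (borel \<Otimes>\<^sub>M M)"
    proof (rule measurable_compose_countable[where g = "\<lambda>p. nat \<lfloor>fst p * real (Suc n)\<rfloor>"
          and f = "\<lambda>i p. W (real i / real (Suc n)) (snd p)"])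
      show "(\<lambda>p. W (real i / real (Suc n)) (snd p)) \<in> borel_measurable (borel \<Otimes>\<^sub>M M)" for i
        using W_measurable[of "real i / real (Suc n)"] by (intro measurable_compose[OF measurable_snd]) auto
      show "(\<lambda>p. nat \<lfloor>fst p * real (Suc n)\<rfloor>) \<in> (borel \<Otimes>\<^sub>M M) \<rightarrow>\<^sub>M count_space UNIV"
        by measurable
    qed
    then show ?thesis by (simp add: V'_def case_prod_beta')
  qed
  have "(\<lambda>p. lim (\<lambda>n. V' n p)) \<in> borel_measurable (borel \<Otimes>\<^sub>M M)"
    using V'_meas by (rule borel_measurable_lim_metric)
  then have "case_prod V \<in> borel_measurable (borel \<Otimes>\<^sub>M M)"
    by (simp add: V_def case_prod_beta')
  moreover have "AE \<omega> in M. \<forall>t\<ge>0. V t \<omega> = W t \<omega>"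
    using W_continuous
  proof eventually_elim
    case (elim \<omega>)
    show ?case
    proof (intro allI impI)
      fix t :: real assume t: "t \<ge> 0"
      have "(\<lambda>n. real (nat \<lfloor>t * real (Suc n)\<rfloor>) / real (Suc n)) \<longlonglongrightarrow> t"
      proof (rule tendsto_sandwich)
        have "t - 1 / real (Suc n) \<le> real (nat \<lfloor>t * real (Suc n)\<rfloor>) / real (Suc n)
            \<and> real (nat \<lfloor>t * real (Suc n)\<rfloor>) / real (Suc n) \<le> t" for n
        proof -
          have "0 \<le> t * real (Suc n)" using t by simp
          then have "real (nat \<lfloor>t * real (Suc n)\<rfloor>) = of_int \<lfloor>t * real (Suc n)\<rfloor>" by simp
          then have "t * real (Suc n) - 1 \<le> real (nat \<lfloor>t * real (Suc n)\<rfloor>)"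
            "real (nat \<lfloor>t * real (Suc n)\<rfloor>) \<le> t * real (Suc n)" by linarith+
          moreover have "t - 1 / m \<le> r / m \<and> r / m \<le> t" if "m > 0" "t * m - 1 \<le> r" "r \<le> t * m" for m r
            using divide_right_mono[OF that(2), of m] divide_right_mono[OF that(3), of m] that(1)
            by (simp add: diff_divide_distrib)
          ultimately show ?thesis by simp
        qed
        then show "\<forall>\<^sub>F n in sequentially. t - 1 / real (Suc n) \<le> real (nat \<lfloor>t * real (Suc n)\<rfloor>) / real (Suc n)"
          "\<forall>\<^sub>F n in sequentially. real (nat \<lfloor>t * real (Suc n)\<rfloor>) / real (Suc n) \<le> t"
          by auto
        have "(\<lambda>n. t - 1 / real (Suc n)) \<longlonglongrightarrow> t - 0"
          by (intro tendsto_intros LIMSEQ_Suc lim_1_over_n)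
        then show "(\<lambda>n. t - 1 / real (Suc n)) \<longlonglongrightarrow> t" by simp
      qed simp
      then have "(\<lambda>n. V' n (t, \<omega>)) \<longlonglongrightarrow> W t \<omega>"
        unfolding V'_def prod.case
        by (rule continuous_on_tendsto_compose[OF elim]) (use t in auto)
      then show "V t \<omega> = W t \<omega>" unfolding V_def by (rule limI)
    qed
  qed
  ultimately show thesis by (rule that)
qed

text \<open>Fubini for time and chance, justified by the dominating function
  \<open>(1 + T) * \<bar>u s\<bar>\<close>; the mean vanishes because every \<open>W s\<close> is
  centred.\<close>

lemma integral_deterministic_times_W:
  fixes u :: "real \<Rightarrow> real"
  assumes u: "integrable lborel u" and "0 \<le> T"
  obtains Z where "integrable M Z" "(\<integral>\<omega>. Z \<omega> \<partial>M) = 0"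
    "AE \<omega> in M. Z \<omega> = (LINT s:{0..T}|lborel. u s * W s \<omega>)"
    "AE \<omega> in M. set_integrable lborel {0..T} (\<lambda>s. u s * W s \<omega>)"
proof -
  obtain V where V: "case_prod V \<in> borel_measurable (borel \<Otimes>\<^sub>M M)"
    and VW: "AE \<omega> in M. \<forall>t\<ge>0. V t \<omega> = W t \<omega>"
    by (rule jointly_measurable_version)
  interpret P: pair_sigma_finite lborel M
    by (intro pair_sigma_finite.intro sigma_finite_lborel sigma_finite_measure_axioms)
  have [measurable]: "u \<in> borel_measurable borel" "case_prod V \<in> borel_measurable (borel \<Otimes>\<^sub>M M)"
    using u V by auto
  define f where "f s \<omega> = indicator {0..T} s *\<^sub>R (u s * V s \<omega>)" for s \<omega>
  have f_meas[measurable]: "case_prod f \<in> borel_measurable (lborel \<Otimes>\<^sub>M M)"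
    unfolding f_def by measurable
  have V_int: "integrable M (V s)" "(\<integral>\<omega>. V s \<omega> \<partial>M) = 0" "(\<integral>\<omega>. \<bar>V s \<omega>\<bar> \<partial>M) \<le> 1 + s" if "0 \<le> s" for s
  proof -
    have ae: "AE \<omega> in M. V s \<omega> = W s \<omega>" using VW that by auto
    have [measurable]: "V s \<in> borel_measurable M" "W s \<in> borel_measurable M"
      using measurable_Pair2[OF V, of s] W_measurable[OF that] by auto
    show "integrable M (V s)"
      using integrable_cong_AE[OF _ _ ae] integrable_W[OF that] by simp
    show "(\<integral>\<omega>. V s \<omega> \<partial>M) = 0"
      using integral_cong_AE[OF _ _ ae] expectation_W[OF that] by simp
    have "(\<integral>\<omega>. \<bar>V s \<omega>\<bar> \<partial>M) = (\<integral>\<omega>. \<bar>W s \<omega>\<bar> \<partial>M)"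
      using ae by (intro integral_cong_AE) auto
    then show "(\<integral>\<omega>. \<bar>V s \<omega>\<bar> \<partial>M) \<le> 1 + s" using expectation_abs_W_le[OF that] by simp
  qed
  have f_zero: "f s = (\<lambda>_. 0)" if "s \<notin> {0..T}" for s using that by (auto simp: f_def)
  have f_in: "f s = (\<lambda>\<omega>. u s * V s \<omega>)" if "s \<in> {0..T}" for s using that by (auto simp: f_def)
  have f_int: "integrable M (f s)" and f_ex: "(\<integral>\<omega>. f s \<omega> \<partial>M) = 0"
    and f_abs: "(\<integral>\<omega>. \<bar>f s \<omega>\<bar> \<partial>M) \<le> (1 + T) * \<bar>u s\<bar>" for s
  proof -
    have *: "integrable M (f s) \<and> (\<integral>\<omega>. f s \<omega> \<partial>M) = 0 \<and> (\<integral>\<omega>. \<bar>f s \<omega>\<bar> \<partial>M) \<le> (1 + T) * \<bar>u s\<bar>"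
    proof (cases "s \<in> {0..T}")
      case True
      then have "\<bar>u s\<bar> * (\<integral>\<omega>. \<bar>V s \<omega>\<bar> \<partial>M) \<le> \<bar>u s\<bar> * (1 + T)"
        using V_int(3)[of s] by (intro mult_left_mono) auto
      then show ?thesis using V_int[of s] True by (simp add: f_in abs_mult mult.commute)
    next
      case False
      then show ?thesis using \<open>0 \<le> T\<close> by (simp add: f_zero)
    qed
    then show "integrable M (f s)" "(\<integral>\<omega>. f s \<omega> \<partial>M) = 0" "(\<integral>\<omega>. \<bar>f s \<omega>\<bar> \<partial>M) \<le> (1 + T) * \<bar>u s\<bar>" by auto
  qed
  have f_integrable: "integrable (lborel \<Otimes>\<^sub>M M) (case_prod f)"
  proof (rule P.Fubini_integrable)
    show "integrable lborel (\<lambda>s. \<integral>\<omega>. norm (case_prod f (s, \<omega>)) \<partial>M)"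
    proof (rule Bochner_Integration.integrable_bound)
      show "integrable lborel (\<lambda>s. (1 + T) * \<bar>u s\<bar>)" using u by simp
      show "(\<lambda>s. \<integral>\<omega>. norm (case_prod f (s, \<omega>)) \<partial>M) \<in> borel_measurable lborel"
        by (intro borel_measurable_lebesgue_integral) measurable
      show "AE s in lborel. norm (\<integral>\<omega>. norm (case_prod f (s, \<omega>)) \<partial>M) \<le> norm ((1 + T) * \<bar>u s\<bar>)"
        using f_abs \<open>0 \<le> T\<close> by simp
    qed
  qed (use f_int in auto)
  \<comment> \<open>Built from the jointly measurable version, so \<open>Z\<close> is a genuine
    random variable; it equals the integral of \<open>W\<close> almost surely.\<close>
  define Z where "Z \<omega> = (\<integral>s. f s \<omega> \<partial>lborel)" for \<omega>
  show thesis
  proof (rule that[of Z])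
    show "integrable M Z" unfolding Z_def by (rule P.integrable_snd[OF f_integrable])
    have "(\<integral>\<omega>. Z \<omega> \<partial>M) = (\<integral>s. (\<integral>\<omega>. f s \<omega> \<partial>M) \<partial>lborel)"
      unfolding Z_def by (rule P.Fubini_integral[OF f_integrable])
    then show "(\<integral>\<omega>. Z \<omega> \<partial>M) = 0" by (simp add: f_ex)
    have eq: "AE \<omega> in M. (\<lambda>s. f s \<omega>) = (\<lambda>s. indicator {0..T} s *\<^sub>R (u s * W s \<omega>))"
      using VW by eventually_elim (auto simp: f_def indicator_def)
    then show "AE \<omega> in M. Z \<omega> = (LINT s:{0..T}|lborel. u s * W s \<omega>)"
      by eventually_elim (simp add: Z_def set_lebesgue_integral_def)
    show "AE \<omega> in M. set_integrable lborel {0..T} (\<lambda>s. u s * W s \<omega>)"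
      using eq P.AE_integrable_snd[OF f_integrable]
      by eventually_elim (simp add: set_integrable_def)
  qed
qed

end

section \<open>Round trips\<close>

text \<open>Bridge from the Lebesgue integrals of the dynamics, whose integrands may fail to be
  Borel, to integrals of Borel representatives; completeness makes \<open>j\<close> measurable on
  \<open>A\<close>.\<close>

lemma set_integral_lebesgue_AE_cong:
  fixes j k :: "real \<Rightarrow> real"
  assumes k: "(\<lambda>s. indicator A s *\<^sub>R k s) \<in> borel_measurable borel"
    and ae: "AE s in lborel. s \<in> A \<longrightarrow> j s = k s"
  shows "(LINT s:A|lebesgue. j s) = (LINT s:A|lborel. k s)" (is ?eq)
    and "set_integrable lebesgue A j \<longleftrightarrow> set_integrable lborel A k" (is ?iff)
proof -
  have k1: "(\<lambda>s. indicator A s *\<^sub>R k s) \<in> borel_measurable lborel" using k by simp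
  have k2: "(\<lambda>s. indicator A s *\<^sub>R k s) \<in> borel_measurable lebesgue"
    using k1 by (rule measurable_completion)
  have ae': "AE s in lebesgue. indicator A s *\<^sub>R k s = indicator A s *\<^sub>R j s"
    unfolding AE_completion_iff using ae by eventually_elim (auto simp: indicator_def)
  have j: "(\<lambda>s. indicator A s *\<^sub>R j s) \<in> borel_measurable lebesgue"
    using completion.borel_measurable_AE_cong[OF k2 ae'] .
  show ?eq
    unfolding set_lebesgue_integral_def integral_cong_AE[OF k2 j ae', symmetric]
    using k1 by (rule integral_completion)
  show ?iff
    unfolding set_integrable_def integrable_cong_AE[OF k2 j ae', symmetric]
    using k1 by (rule integrable_completion)
qed

text \<open>Fubini on the triangle \<open>0 \<le> r \<le> s \<le> T\<close>, where
  \<open>\<bar>u s\<bar> * \<bar>\<phi> r\<bar>\<close> dominates.\<close>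

lemma triangle_integral_swap:
  fixes u \<phi> :: "real \<Rightarrow> real"
  assumes u: "integrable lborel u" and \<phi>: "integrable lborel \<phi>"
  shows "integrable lborel (\<lambda>s. indicator {0..T} s *\<^sub>R (u s * (LINT r:{0..s}|lborel. \<phi> r)))"
    and "(LINT s:{0..T}|lborel. u s * (LINT r:{0..s}|lborel. \<phi> r))
      = (LINT r:{0..T}|lborel. \<phi> r * (LINT s:{r..T}|lborel. u s))"
proof -
  have [measurable]: "u \<in> borel_measurable borel" "\<phi> \<in> borel_measurable borel" using assms by auto
  define h :: "real \<Rightarrow> real \<Rightarrow> real" where "h s r = (if 0 \<le> r \<and> r \<le> s \<and> s \<le> T then u s * \<phi> r else 0)" for s r
  have h1: "h s r = indicator {0..T} s * u s * (indicator {0..s} r * \<phi> r)" for s r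
    by (auto simp: h_def indicator_def)
  have h2: "h s r = indicator {0..T} r * \<phi> r * (indicator {r..T} s * u s)" for s r
    by (auto simp: h_def indicator_def)
  have h_meas[measurable]: "case_prod h \<in> borel_measurable (lborel \<Otimes>\<^sub>M lborel)"
    unfolding h_def by measurable
  have ind: "integrable lborel (\<lambda>r. indicator A r * w r)" if "integrable lborel w" "A \<in> sets borel"
    for A and w :: "real \<Rightarrow> real"
    using integrable_mult_indicator[of A lborel w] that by simp
  have h_int: "integrable (lborel \<Otimes>\<^sub>M lborel) (case_prod h)"
  proof (rule lborel_pair.Fubini_integrable[OF h_meas])
    show "integrable lborel (\<lambda>s. \<integral>r. norm (case_prod h (s, r)) \<partial>lborel)"
    proof (rule Bochner_Integration.integrable_bound)
      show "integrable lborel (\<lambda>s. (\<integral>r. \<bar>\<phi> r\<bar> \<partial>lborel) * \<bar>u s\<bar>)" using u by simp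
      show "(\<lambda>s. \<integral>r. norm (case_prod h (s, r)) \<partial>lborel) \<in> borel_measurable lborel"
        by (intro lborel.borel_measurable_lebesgue_integral) measurable
      have "(\<integral>r. norm (h s r) \<partial>lborel) \<le> (\<integral>r. \<bar>u s\<bar> * \<bar>\<phi> r\<bar> \<partial>lborel)" for s
      proof (rule integral_mono)
        show "integrable lborel (\<lambda>r. norm (h s r))"
          unfolding h1 using \<phi> by (intro integrable_norm integrable_mult_right ind) auto
      qed (use \<phi> in \<open>auto simp: h_def abs_mult\<close>)
      moreover have "0 \<le> (\<integral>r. norm (h s r) \<partial>lborel)" for s by simp
      ultimately show "AE s in lborel. norm (\<integral>r. norm (case_prod h (s, r)) \<partial>lborel)
          \<le> norm ((\<integral>r. \<bar>\<phi> r\<bar> \<partial>lborel) * \<bar>u s\<bar>)"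
        by (auto simp: mult.commute)
    qed
    show "AE s in lborel. integrable lborel (\<lambda>r. case_prod h (s, r))"
      unfolding prod.case h1 using \<phi> by (intro AE_I2 integrable_mult_right ind) auto
  qed
  have 1: "(\<integral>r. h s r \<partial>lborel) = indicator {0..T} s *\<^sub>R (u s * (LINT r:{0..s}|lborel. \<phi> r))" for s
    unfolding h1 set_lebesgue_integral_def by simp
  have 2: "(\<integral>s. h s r \<partial>lborel) = indicator {0..T} r *\<^sub>R (\<phi> r * (LINT s:{r..T}|lborel. u s))" for r
    unfolding h2 set_lebesgue_integral_def by simp
  show "integrable lborel (\<lambda>s. indicator {0..T} s *\<^sub>R (u s * (LINT r:{0..s}|lborel. \<phi> r)))"
    using lborel_pair.integrable_fst[OF h_int] unfolding 1 .
  show "(LINT s:{0..T}|lborel. u s * (LINT r:{0..s}|lborel. \<phi> r))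
      = (LINT r:{0..T}|lborel. \<phi> r * (LINT s:{r..T}|lborel. u s))"
    using lborel_pair.Fubini_integral[OF h_int] unfolding 1 2 set_lebesgue_integral_def by simp
qed

text \<open>A Lebesgue measurable \<open>f\<close> may be replaced by a Borel version \<open>f'\<close>: the exceptional null set \<open>N\<close> can
  have a preimage of positive measure, but there \<open>q\<close> has zero derivative almost everywhere.\<close>

lemma AE_composed_with_density:
  fixes f q g :: "real \<Rightarrow> real"
  assumes der: "AE t in lborel. t \<in> {0..T} \<longrightarrow> (q has_real_derivative g t) (at t within {0..T})"
    and bound: "\<And>t. t \<in> {0..T} \<Longrightarrow> \<bar>q 0 - q t\<bar> \<le> R"
    and f: "AE y in lborel. y \<in> {0..R} \<longrightarrow> f y = f' y"
  shows "AE t in lborel. t \<in> {0..T} \<longrightarrow> f \<bar>q 0 - q t\<bar> * g t = f' \<bar>q 0 - q t\<bar> * g t"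
proof -
  define N where "N = {y \<in> {0..R}. f y \<noteq> f' y}"
  have "AE y in lebesgue. y \<notin> N"
    unfolding AE_completion_iff using f by eventually_elim (simp add: N_def)
  then have N: "negligible N"
    by (simp add: negligible_iff_null_sets completion.null_sets_iff_AE)
  define E where "E = {t \<in> {0..T}. (q has_real_derivative g t) (at t within {0..T}) \<and> g t \<noteq> 0 \<and> \<bar>q 0 - q t\<bar> \<in> N}"
  have "negligible E"
  proof (rule negligible_of_negligible_image_nonzero_derivative)
    have "negligible ((\<lambda>y. q 0 - y) ` N \<union> (\<lambda>y. q 0 + y) ` N)"
      using N by (intro negligible_Un negligible_differentiable_image_negligible)
        (auto simp: differentiable_on_def intro!: derivative_intros)
    moreover have "q ` E \<subseteq> (\<lambda>y. q 0 - y) ` N \<union> (\<lambda>y. q 0 + y) ` N"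
    proof
      fix z assume "z \<in> q ` E"
      then have z: "\<bar>q 0 - z\<bar> \<in> N" by (auto simp: E_def)
      have "z = q 0 - \<bar>q 0 - z\<bar> \<or> z = q 0 + \<bar>q 0 - z\<bar>" by linarith
      with z show "z \<in> (\<lambda>y. q 0 - y) ` N \<union> (\<lambda>y. q 0 + y) ` N" by blast
    qed
    ultimately show "negligible (q ` E)" by (rule negligible_subset)
  qed (auto simp: E_def)
  then have "AE t in lborel. t \<notin> E" by (rule AE_negligible_lborel)
  with der show ?thesis
  proof eventually_elim
    case (elim t)
    show ?case
    proof
      assume t: "t \<in> {0..T}"
      show "f \<bar>q 0 - q t\<bar> * g t = f' \<bar>q 0 - q t\<bar> * g t"
        using elim t bound[OF t] by (cases "g t = 0") (auto simp: E_def N_def)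
    qed
  qed
qed

theorem proposition2:
  fixes M :: "'a measure" and F :: "real \<Rightarrow> 'a measure"
    and W S X :: "real \<Rightarrow> 'a \<Rightarrow> real"
    and T \<sigma> S\<^sub>0 X\<^sub>0 :: real
    and f q v :: "real \<Rightarrow> real" and h :: "real \<Rightarrow> real \<Rightarrow> real"
  assumes "brownian_motion M F W"
    and "T > 0" and "\<sigma> > 0"
    and "\<And>x. x \<ge> 0 \<Longrightarrow> f x \<ge> 0" and "locally_integrable_halfline f"
    and "(\<lambda>(t, x). h t x) \<in> borel_measurable (restrict_space borel ({0..T} \<times> UNIV))"
    and "\<And>t x. t \<in> {0..T} \<Longrightarrow> h t x * x \<ge> 0"
    and "absolutely_continuous_fun_on {0..T} q" and "q 0 = q T"
    and "trading_rate T q v"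
    and "set_integrable lebesgue {0..T} (\<lambda>t. f \<bar>q 0 - q t\<bar> * v t)"
    and "set_integrable lebesgue {0..T} (\<lambda>t. h t (v t) * v t)"
    and "price_process M W T \<sigma> f q v S\<^sub>0 S"
    and "cash_process M T h v S X\<^sub>0 X"
  shows "integrable M (X T) \<and> (\<integral>\<omega>. X T \<omega> \<partial>M) \<le> X\<^sub>0"
proof -
  interpret brownian_motion M F W by fact
  have "0 \<le> T" using \<open>T > 0\<close> by simp
  note ac = \<open>absolutely_continuous_fun_on {0..T} q\<close>
  obtain g where g: "g \<in> borel_measurable borel" "integrable lborel g"
    and q: "\<And>a b. 0 \<le> a \<Longrightarrow> a \<le> b \<Longrightarrow> b \<le> T \<Longrightarrow> q b - q a = (LINT x:{a..b}|lborel. g x)"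
    using absolutely_continuous_fun_on_density[OF ac \<open>0 \<le> T\<close>] by metis
  have der: "AE t in lborel. t \<in> {0..T} \<longrightarrow> (q has_real_derivative g t) (at t within {0..T})"
    by (rule AE_has_derivative_indefinite_integral[OF g(2) q])
  \<comment> \<open>\<open>trading_rate\<close> prescribes \<open>v\<close> only where
    \<open>q\<close> is differentiable, which by \<open>der\<close> is almost everywhere in
    \<open>{0..T}\<close>.\<close>
  then have v: "AE t in lborel. t \<in> {0..T} \<longrightarrow> v t = - g t"
    by eventually_elim (use \<open>trading_rate T q v\<close> in \<open>auto simp: trading_rate_def\<close>)
  \<comment> \<open>Clamping the time gives a path continuous on the whole line, as the loop results
    require, and changes nothing on \<open>{0..T}\<close>.\<close>
  define x where "x t = q (max 0 (min T t)) - q 0" for t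
  have x_cont: "continuous_on UNIV x" unfolding x_def
    using \<open>0 \<le> T\<close> by (intro continuous_intros continuous_on_compose2[OF absolutely_continuous_fun_on_imp_continuous_on[OF ac]]) auto
  have x_eq: "x t = q t - q 0" if "t \<in> {0..T}" for t using that by (simp add: x_def)
  have x: "x b - x a = (LINT s:{a..b}|lborel. g s)" if "0 \<le> a" "a \<le> b" "b \<le> T" for a b
    using q[OF that] that by (simp add: x_eq)
  have x_ends: "x 0 = 0" "x T = 0" using \<open>0 \<le> T\<close> \<open>q 0 = q T\<close> by (simp_all add: x_eq)
  have [measurable]: "g \<in> borel_measurable borel" "x \<in> borel_measurable borel"
    using g x_cont by (auto intro: borel_measurable_continuous_onI)
  have "bounded (x ` {0..T})"
    by (intro compact_imp_bounded compact_continuous_image continuous_on_subset[OF x_cont]) auto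
  then obtain R where R: "\<forall>t\<in>{0..T}. \<bar>x t\<bar> \<le> R" unfolding bounded_iff by auto
  have x_abs: "\<bar>q 0 - q t\<bar> = \<bar>x t\<bar>" if "t \<in> {0..T}" for t using that by (simp add: x_eq abs_minus_commute)
  \<comment> \<open>The path visits only distances up to \<open>R\<close>, so local integrability on
    one compact set yields the Borel version \<open>f'\<close>.\<close>
  have "set_integrable lebesgue {0..R} f"
    using \<open>locally_integrable_halfline f\<close> unfolding locally_integrable_halfline_def by auto
  then have "(\<lambda>y. indicator {0..R} y *\<^sub>R f y) \<in> borel_measurable lebesgue"
    unfolding set_integrable_def by auto
  then obtain f' where f': "f' \<in> borel_measurable lborel" "AE y in lborel. indicator {0..R} y *\<^sub>R f y = f' y"
    using completion_ex_borel_measurable_real by blast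
  have [measurable]: "f' \<in> borel_measurable borel" using f'(1) by simp
  have "AE y in lborel. y \<in> {0..R} \<longrightarrow> f y = f' y" using f'(2) by eventually_elim auto
  from AE_composed_with_density[OF der _ this]
  have fg: "AE t in lborel. t \<in> {0..T} \<longrightarrow> f \<bar>q 0 - q t\<bar> * g t = f' \<bar>q 0 - q t\<bar> * g t"
    using R x_abs by simp
  \<comment> \<open>Borel representative of the impact term, with \<open>- g\<close> in place of
    \<open>v\<close>.\<close>
  define \<phi> where "\<phi> t = indicator {0..T} t * (f' \<bar>x t\<bar> * (- g t))" for t
  have \<phi>_meas[measurable]: "\<phi> \<in> borel_measurable borel" unfolding \<phi>_def[abs_def] by measurable
  have \<phi>_AE: "AE t in lborel. t \<in> {0..T} \<longrightarrow> f \<bar>q 0 - q t\<bar> * v t = \<phi> t"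
    using v fg by eventually_elim (auto simp: \<phi>_def x_abs)
  have "set_integrable lborel {0..T} \<phi>"
    using set_integral_lebesgue_AE_cong(2)[OF _ \<phi>_AE] \<open>set_integrable lebesgue {0..T} (\<lambda>t. f \<bar>q 0 - q t\<bar> * v t)\<close> by simp
  then have \<phi>_int: "integrable lborel \<phi>"
    unfolding set_integrable_def by (rule Bochner_Integration.integrable_bound) (auto simp: \<phi>_def indicator_def)
  define \<Phi> where "\<Phi> t = (LINT s:{0..t}|lborel. \<phi> s)" for t
  have impact: "(LINT s:{0..t}|lebesgue. f \<bar>q 0 - q s\<bar> * v s) = \<Phi> t" if "t \<in> {0..T}" for t
    unfolding \<Phi>_def using \<phi>_AE that by (intro set_integral_lebesgue_AE_cong) auto
  have u_int: "integrable lborel (\<lambda>t. - g t)" using g by simp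
  have u_zero: "(LINT s:{0..T}|lborel. - g s) = 0"
    using x[of 0 T] x_ends \<open>0 \<le> T\<close> by (simp add: set_lebesgue_integral_def)
  have tail: "(LINT s:{r..T}|lborel. - g s) = x r" if "r \<in> {0..T}" for r
    using x[of r T] x_ends that by (simp add: set_lebesgue_integral_def)
  \<comment> \<open>Integrability is inherited from \<open>\<phi>\<close>, since the extra factor
    \<open>x s\<close> is bounded by \<open>R\<close>.\<close>
  have loop: "(LINT s:{0..T}|lborel. (x s * f' \<bar>x s\<bar>) * g s) = 0"
  proof (rule loop_integral_eq_0[OF g(2) \<open>0 \<le> T\<close> x x_cont, where F = "\<lambda>y. y * f' \<bar>y\<bar>"])
    show "x 0 = x T" using x_ends by simp
    show "set_integrable lborel {0..T} (\<lambda>s. x s * f' \<bar>x s\<bar> * g s)"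
      unfolding set_integrable_def
    proof (rule Bochner_Integration.integrable_bound)
      show "integrable lborel (\<lambda>s. R * \<phi> s)" using \<phi>_int by simp
      have "norm (indicator {0..T} s *\<^sub>R (x s * f' \<bar>x s\<bar> * g s)) \<le> norm (R * \<phi> s)" for s
      proof (cases "s \<in> {0..T}")
        case True
        then have "\<bar>x s\<bar> \<le> \<bar>R\<bar>" using R by force
        from mult_right_mono[OF this, of "\<bar>f' \<bar>x s\<bar>\<bar> * \<bar>g s\<bar>"] show ?thesis
          using True by (simp add: \<phi>_def abs_mult mult.assoc)
      qed simp
      then show "AE s in lborel. norm (indicator {0..T} s *\<^sub>R (x s * f' \<bar>x s\<bar> * g s)) \<le> norm (R * \<phi> s)" by simp
    qed measurable
  qed measurable
  \<comment> \<open>The inner tail integral equals \<open>x r\<close> because the path returns to 0,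
    so the double integral is the loop integral up to sign.\<close>
  have "(LINT s:{0..T}|lborel. - g s * \<Phi> s) = (LINT r:{0..T}|lborel. \<phi> r * (LINT s:{r..T}|lborel. - g s))"
    unfolding \<Phi>_def by (rule triangle_integral_swap(2)[OF u_int \<phi>_int])
  also have "\<dots> = (LINT r:{0..T}|lborel. - ((x r * f' \<bar>x r\<bar>) * g r))"
    by (rule set_lebesgue_integral_cong) (auto simp: tail \<phi>_def)
  also have "\<dots> = 0" using loop by (simp add: set_lebesgue_integral_def)
  finally have u\<Phi>_zero: "(LINT s:{0..T}|lborel. - g s * \<Phi> s) = 0" .
  have u\<Phi>_int: "set_integrable lborel {0..T} (\<lambda>s. - g s * \<Phi> s)"
    unfolding set_integrable_def \<Phi>_def by (rule triangle_integral_swap(1)[OF u_int \<phi>_int])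
  obtain Z where Z: "integrable M Z" "(\<integral>\<omega>. Z \<omega> \<partial>M) = 0"
    and Z_eq: "AE \<omega> in M. Z \<omega> = (LINT s:{0..T}|lborel. - g s * W s \<omega>)"
    and uW_int: "AE \<omega> in M. set_integrable lborel {0..T} (\<lambda>s. - g s * W s \<omega>)"
    using integral_deterministic_times_W[OF u_int \<open>0 \<le> T\<close>] by metis
  define c where "c = (LINT s:{0..T}|lebesgue. h s (v s) * v s)"
  have c: "c \<ge> 0"
    unfolding c_def set_lebesgue_integral_def
    using assms(7) by (intro integral_nonneg_AE AE_I2) (auto simp: indicator_def)
  \<comment> \<open>The measurable expression stands on the left, so that completeness hands its
    measurability, and then its integrability, over to \<open>X T\<close>.\<close>
  have X_eq: "AE \<omega> in M. X\<^sub>0 + \<sigma> * Z \<omega> - c = X T \<omega>"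
    using \<open>price_process M W T \<sigma> f q v S\<^sub>0 S\<close>[unfolded price_process_def]
      \<open>cash_process M T h v S X\<^sub>0 X\<close>[unfolded cash_process_def] Z_eq uW_int
  proof eventually_elim
    case (elim \<omega>)
    note S = elim(1)
    \<comment> \<open>\<open>v s * S s \<omega>\<close> with \<open>- g s\<close> for
      \<open>v s\<close>, split into initial price, noise and accumulated impact; each part is
      integrable, so the integral splits too.\<close>
    let ?k = "\<lambda>s. S\<^sub>0 * (- g s) + \<sigma> * (- g s * W s \<omega>) - (- g s * \<Phi> s)"
    have u_set: "set_integrable lborel {0..T} (\<lambda>s. - g s)"
      unfolding set_integrable_def by (rule integrable_mult_indicator[OF _ u_int]) simp
    have int: "set_integrable lborel {0..T} (\<lambda>s. S\<^sub>0 * (- g s))"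
      by (rule set_integrable_mult_right) (rule u_set)
    have int': "set_integrable lborel {0..T} (\<lambda>s. \<sigma> * (- g s * W s \<omega>))"
      by (rule set_integrable_mult_right) (rule elim(4))
    have k_int: "set_integrable lborel {0..T} ?k"
      by (intro set_integral_diff set_integral_add int int' u\<Phi>_int)
    have "AE s in lborel. s \<in> {0..T} \<longrightarrow> v s * S s \<omega> = ?k s"
      using v
    proof eventually_elim
      case (elim s)
      show ?case
      proof
        assume s: "s \<in> {0..T}"
        have S_eq: "S s \<omega> = S\<^sub>0 + \<sigma> * W s \<omega> - \<Phi> s" using S s impact[OF s] by simp
        have v_eq: "v s = - g s" using elim s by blast
        show "v s * S s \<omega> = ?k s" unfolding S_eq v_eq by (simp add: algebra_simps)
      qed
    qed
    then have "(LINT s:{0..T}|lebesgue. v s * S s \<omega>) = (LINT s:{0..T}|lborel. ?k s)"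
      using k_int unfolding set_integrable_def by (intro set_integral_lebesgue_AE_cong) auto
    also have "\<dots> = S\<^sub>0 * (LINT s:{0..T}|lborel. - g s) + \<sigma> * (LINT s:{0..T}|lborel. - g s * W s \<omega>)
        - (LINT s:{0..T}|lborel. - g s * \<Phi> s)"
      using int int' u\<Phi>_int by (simp only: set_integral_diff set_integral_add set_integral_mult_right)
    also have "\<dots> = \<sigma> * Z \<omega>" unfolding u_zero u\<Phi>_zero elim(3) by simp
    finally show ?case using elim(2) \<open>0 \<le> T\<close> by (auto simp: c_def)
  qed
  have Y: "integrable M (\<lambda>\<omega>. X\<^sub>0 + \<sigma> * Z \<omega> - c)" using Z(1) by simp
  have X_meas: "X T \<in> borel_measurable M"
    using borel_measurable_integrable[OF Y] X_eq by (rule borel_measurable_AE_cong)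
  have "integrable M (X T)"
    using Y integrable_cong_AE[OF borel_measurable_integrable[OF Y] X_meas X_eq] by simp
  moreover have "(\<integral>\<omega>. X T \<omega> \<partial>M) = (\<integral>\<omega>. X\<^sub>0 + \<sigma> * Z \<omega> - c \<partial>M)"
    using integral_cong_AE[OF borel_measurable_integrable[OF Y] X_meas X_eq] by simp
  moreover have "(\<integral>\<omega>. X\<^sub>0 + \<sigma> * Z \<omega> - c \<partial>M) = X\<^sub>0 - c"
    using Z by (simp add: prob_space)
  ultimately show ?thesis using c by simp
qed

end
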